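(* The solution of the stochastic steady Navier–Stokes system $$(A)\quad -\nu\Delta\mathbf u+(\mathbf u\cdot\nabla)\mathbf u+\nabla p=\mathbf F+\sigma\tfrac{d\mathbf W}{d\mathbf x},\quad \nabla\cdot\mathbf u=0\ \text{ in }\Omega,\quad \mathbf u|_{\partial\Omega}=\mathbf 0$$ is equivalent to the sum $\mathbf u=\boldsymbol\xi+\boldsymbol\eta$ of the solutions of $$(B)\quad -\nu\Delta\boldsymbol\xi+(\boldsymbol\xi\cdot\nabla)\boldsymbol\xi+\nabla p_1=\mathbf F,\quad\nabla\cdot\boldsymbol\xi=0\ \text{ in }\Omega,\quad\boldsymbol\xi|_{\partial\Omega}=\mathbf 0,$$ $$(C)\quad -\nu\Delta\boldsymbol\eta+(\boldsymbol\eta\cdot\nabla)\boldsymbol\eta+(\boldsymbol\eta\cdot\nabla)\boldsymbol\xi+(\boldsymbol\xi\cdot\nabla)\boldsymbol\eta+\nabla p_2=\sigma\tfrac{d\mathbf W}{d\mathbf x},\quad\nabla\cdot\boldsymbol\eta=0\ \text{ in }\Omega,\quad\boldsymbol\eta|_{\partial\Omega}=\mathbf 0.$$ That is: (i) if $\boldsymbol\xi$ solves (B) (with some pressure $p_1$) and $\boldsymbol\eta$ solves (C) (with some pressure $p_2$), then $\mathbf u=\boldsymbol\xi+\boldsymbol\eta$ solves (A) (with some pressure $p$); (ii) conversely, if $\mathbf u$ solves (A) (with some pressure $p$) and $\boldsymbol\xi$ solves (B) (with some pressure $p_1$), then $\boldsymbol\eta=\mathbf u-\boldsymbol\xi$ solves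 (C) (with some pressure $p_2$).
   Context: $\Omega\subset\mathbb R^2$ is open, bounded and connected with Lipschitz boundary; $\nu>0$ is the constant viscosity; $\mathbf F$ is a deterministic $\mathbb R^2$-valued body force; $(\Theta,\mathcal F,\mu)$ is a probability space with expectation $\mathbb E$; $\sigma\frac{d\mathbf W}{d\mathbf x}$ is an $\mathbb R^2$-valued additive spatial random forcing. Velocities are $\mathbb R^2$-valued, and the spaces below are used componentwise for them. Solutions are understood in the weak sense: $\mathbf u,\boldsymbol\eta\in\mathbb V_0=L^2(\Theta;H^1_0(\Omega))$, $\boldsymbol\xi\in H^1_0(\Omega)$ (deterministic), pressures in $\mathbb W_0=L^2(\Theta;L^2_0(\Omega))$, where $L^2_0(\Omega)=\{q\in L^2(\Omega):\int_\Omega q=0\}$, and for all $(\mathbf v,q)\in\mathbb V_0\times\mathbb W_0$: (A): $\mathbb E[a(\mathbf u,\mathbf v)+c(\mathbf u,\mathbf u,\mathbf v)+b(\mathbf v,p)]=\mathbb E[(\mathbf F+\sigma\frac{d\mathbf W}{d\mathbf x},\mathbf v)]$, $\mathbb E[b(\mathbf u,q)]=0$; (B): $\mathbb E[a(\boldsymbol\xi,\mathbf v)+c(\boldsymbol\xi,\boldsymbol\xi,\mathbf v)+b(\mathbf v,p_1)]=\mathbb E[(\mathbf F,\mathbf v)]$, $\mathbb E[b(\boldsymbol\xi,q)]=0$; (C): $\mathbb E[a(\boldsymbol\eta,\mathbf v)+c(\boldsymbol\eta,\boldsymbol\eta,\mathbf v)+c(\boldsymbol\eta,\boldsymbol\xi,\mathbf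 v)+c(\boldsymbol\xi,\boldsymbol\eta,\mathbf v)+b(\mathbf v,p_2)]=\mathbb E[(\sigma\frac{d\mathbf W}{d\mathbf x},\mathbf v)]$, $\mathbb E[b(\boldsymbol\eta,q)]=0$. Here $(\cdot,\cdot)$ is the $L^2(\Omega)$ inner product (also the duality pairing), $a(\mathbf u,\mathbf v)=\nu\int_\Omega\nabla\mathbf u:\nabla\mathbf v$, $b(\mathbf u,q)=-\int_\Omega q\,\nabla\cdot\mathbf u$, $c(\mathbf u,\mathbf w,\mathbf v)=\int_\Omega\sum_{i,j}u_j\frac{\partial w_i}{\partial x_j}v_i$. *)

theory Defs
  imports "HOL-Analysis.Analysis" "HOL-Probability.Probability"
begin

text \<open>
  Elements of function spaces over \<open>\<Omega>\<close> are represented by functions on the whole plane whose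
  values outside \<open>\<Omega>\<close> are irrelevant; instead of passing to classes modulo null sets, the norms
  below are seminorms on representatives.
\<close>

type_synonym plane = "real ^ 2"
type_synonym scalar_field = "plane \<Rightarrow> real"
type_synonym vector_field = "plane \<Rightarrow> plane"

text \<open>
  Near every boundary point, after a rigid change of coordinates, \<open>\<Omega>\<close> is the strict epigraph of
  a Lipschitz function.
\<close>

definition lipschitz_boundary :: "plane set \<Rightarrow> bool" where
  "lipschitz_boundary \<Omega> \<longleftrightarrow>
     (\<forall>z \<in> frontier \<Omega>. \<exists>(U :: plane set) (Q :: plane \<Rightarrow> plane) (\<gamma> :: real \<Rightarrow> real) L.
        open U \<and> z \<in> U \<and> orthogonal_transformation Q \<and>
        L-lipschitz_on UNIV \<gamma> \<and>
        \<Omega> \<inter> U = {x \<in> U. \<gamma> (Q x $ 1) < Q x $ 2})"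

definition pderiv_at :: "2 \<Rightarrow> scalar_field \<Rightarrow> scalar_field" where
  "pderiv_at j f x = frechet_derivative f (at x) (axis j 1)"

fun C_k :: "nat \<Rightarrow> scalar_field \<Rightarrow> bool" where
  "C_k 0 f \<longleftrightarrow> continuous_on UNIV f"
| "C_k (Suc k) f \<longleftrightarrow> (\<forall>x. f differentiable (at x)) \<and> (\<forall>j. C_k k (pderiv_at j f))"

definition test_functions :: "plane set \<Rightarrow> scalar_field set" where
  "test_functions \<Omega> = {\<phi>. (\<forall>k. C_k k \<phi>) \<and>
     compact (closure {x. \<phi> x \<noteq> 0}) \<and> closure {x. \<phi> x \<noteq> 0} \<subseteq> \<Omega>}"

definition L2 :: "plane set \<Rightarrow> scalar_field set" where
  "L2 \<Omega> = {f. f \<in> borel_measurable (lebesgue_on \<Omega>) \<and> integrable (lebesgue_on \<Omega>) (\<lambda>x. (f x)\<^sup>2)}"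

definition L2_norm :: "plane set \<Rightarrow> scalar_field \<Rightarrow> real" where
  "L2_norm \<Omega> f = sqrt (\<integral>x. (f x)\<^sup>2 \<partial>lebesgue_on \<Omega>)"

definition L2_0 :: "plane set \<Rightarrow> scalar_field set" where
  "L2_0 \<Omega> = {q \<in> L2 \<Omega>. (\<integral>x. q x \<partial>lebesgue_on \<Omega>) = 0}"

definition L1_loc :: "plane set \<Rightarrow> scalar_field set" where
  "L1_loc \<Omega> = {f. \<forall>K. compact K \<and> K \<subseteq> \<Omega> \<longrightarrow> integrable (lebesgue_on K) f}"

definition has_weak_pderiv :: "plane set \<Rightarrow> 2 \<Rightarrow> scalar_field \<Rightarrow> scalar_field \<Rightarrow> bool" where
  "has_weak_pderiv \<Omega> j f g \<longleftrightarrow> f \<in> L1_loc \<Omega> \<and> g \<in> L1_loc \<Omega> \<and>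
     (\<forall>\<phi> \<in> test_functions \<Omega>.
        (\<integral>x. f x * pderiv_at j \<phi> x \<partial>lebesgue_on \<Omega>) = - (\<integral>x. g x * \<phi> x \<partial>lebesgue_on \<Omega>))"

text \<open>Weak derivatives are unique up to null sets, so the choice is immaterial under integrals.\<close>

definition weak_pderiv :: "plane set \<Rightarrow> 2 \<Rightarrow> scalar_field \<Rightarrow> scalar_field" where
  "weak_pderiv \<Omega> j f = (SOME g. has_weak_pderiv \<Omega> j f g)"

definition H1 :: "plane set \<Rightarrow> scalar_field set" where
  "H1 \<Omega> = {f \<in> L2 \<Omega>. \<forall>j. \<exists>g \<in> L2 \<Omega>. has_weak_pderiv \<Omega> j f g}"

definition H1_norm :: "plane set \<Rightarrow> scalar_field \<Rightarrow> real" where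
  "H1_norm \<Omega> f = sqrt ((L2_norm \<Omega> f)\<^sup>2 + (\<Sum>j\<in>UNIV. (L2_norm \<Omega> (weak_pderiv \<Omega> j f))\<^sup>2))"

definition H1_0 :: "plane set \<Rightarrow> scalar_field set" where
  "H1_0 \<Omega> = {f \<in> H1 \<Omega>. \<forall>\<epsilon>>0. \<exists>\<phi> \<in> test_functions \<Omega>. H1_norm \<Omega> (\<lambda>x. f x - \<phi> x) < \<epsilon>}"

definition vH1_0 :: "plane set \<Rightarrow> vector_field set" where
  "vH1_0 \<Omega> = {u. \<forall>i. (\<lambda>x. u x $ i) \<in> H1_0 \<Omega>}"

definition vH1_norm :: "plane set \<Rightarrow> vector_field \<Rightarrow> real" where
  "vH1_norm \<Omega> u = sqrt (\<Sum>i\<in>UNIV. (H1_norm \<Omega> (\<lambda>x. u x $ i))\<^sup>2)"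

text \<open>
  The dual \<open>H\<^sup>-\<^sup>1(\<Omega>)\<close> of the vector-valued \<open>H\<^sup>1\<^sub>0(\<Omega>)\<close>. A field \<open>f\<close> in \<open>L\<^sup>2(\<Omega>)\<close> is identified with the
  functional mapping \<open>v\<close> to the integral of \<open>f \<bullet> v\<close> over \<open>\<Omega>\<close>, so that application \<open>F v\<close>
  is the duality pairing \<open>(F, v)\<close>.
\<close>

definition Hminus1 :: "plane set \<Rightarrow> (vector_field \<Rightarrow> real) set" where
  "Hminus1 \<Omega> = {F.
     (\<forall>u \<in> vH1_0 \<Omega>. \<forall>v \<in> vH1_0 \<Omega>. F (\<lambda>x. u x + v x) = F u + F v) \<and>
     (\<forall>r. \<forall>v \<in> vH1_0 \<Omega>. F (\<lambda>x. r *\<^sub>R v x) = r * F v) \<and>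
     (\<exists>C. \<forall>v \<in> vH1_0 \<Omega>. \<bar>F v\<bar> \<le> C * vH1_norm \<Omega> v)}"

definition Hminus1_norm :: "plane set \<Rightarrow> (vector_field \<Rightarrow> real) \<Rightarrow> real" where
  "Hminus1_norm \<Omega> F = (SUP v \<in> {v \<in> vH1_0 \<Omega>. vH1_norm \<Omega> v \<le> 1}. \<bar>F v\<bar>)"

text \<open>
  \<open>L\<^sup>2(\<Theta>; X)\<close> for a space \<open>X\<close> of functions with seminorm \<open>N\<close>: strongly measurable maps, i.e.
  pointwise limits of simple \<open>X\<close>-valued maps, with square-integrable norm. Convergence is required
  everywhere rather than almost everywhere, so that real-valued expressions in such maps are
  measurable although the probability space need not be complete; up to modification on null sets
  both notions coincide.
\<close>

definition strongly_measurable ::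
    "'t measure \<Rightarrow> ('a \<Rightarrow> 'b::real_vector) set \<Rightarrow> (('a \<Rightarrow> 'b) \<Rightarrow> real) \<Rightarrow> ('t \<Rightarrow> 'a \<Rightarrow> 'b) \<Rightarrow> bool" where
  "strongly_measurable M X N u \<longleftrightarrow>
     (\<exists>s. (\<forall>n. simple_function M (s n) \<and> (\<forall>\<theta> \<in> space M. s n \<theta> \<in> X)) \<and>
          (\<forall>\<theta> \<in> space M. (\<lambda>n. N (\<lambda>x. s n \<theta> x - u \<theta> x)) \<longlonglongrightarrow> 0))"

definition Bochner_L2 ::
    "'t measure \<Rightarrow> ('a \<Rightarrow> 'b::real_vector) set \<Rightarrow> (('a \<Rightarrow> 'b) \<Rightarrow> real) \<Rightarrow> ('t \<Rightarrow> 'a \<Rightarrow> 'b) set" where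
  "Bochner_L2 M X N = {u. (\<forall>\<theta> \<in> space M. u \<theta> \<in> X) \<and> strongly_measurable M X N u \<and>
     integrable M (\<lambda>\<theta>. (N (u \<theta>))\<^sup>2)}"

definition V\<^sub>0 :: "'t measure \<Rightarrow> plane set \<Rightarrow> ('t \<Rightarrow> vector_field) set" where
  "V\<^sub>0 M \<Omega> = Bochner_L2 M (vH1_0 \<Omega>) (vH1_norm \<Omega>)"

definition W\<^sub>0 :: "'t measure \<Rightarrow> plane set \<Rightarrow> ('t \<Rightarrow> scalar_field) set" where
  "W\<^sub>0 M \<Omega> = Bochner_L2 M (L2_0 \<Omega>) (L2_norm \<Omega>)"

definition random_forcings :: "'t measure \<Rightarrow> plane set \<Rightarrow> ('t \<Rightarrow> vector_field \<Rightarrow> real) set" where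
  "random_forcings M \<Omega> = Bochner_L2 M (Hminus1 \<Omega>) (Hminus1_norm \<Omega>)"

abbreviation D :: "plane set \<Rightarrow> 2 \<Rightarrow> 2 \<Rightarrow> vector_field \<Rightarrow> scalar_field" where
  "D \<Omega> j i u \<equiv> weak_pderiv \<Omega> j (\<lambda>x. u x $ i)"

definition a_form :: "plane set \<Rightarrow> real \<Rightarrow> vector_field \<Rightarrow> vector_field \<Rightarrow> real" where
  "a_form \<Omega> \<nu> u v = \<nu> * (\<integral>x. (\<Sum>i\<in>UNIV. \<Sum>j\<in>UNIV. D \<Omega> j i u x * D \<Omega> j i v x) \<partial>lebesgue_on \<Omega>)"

definition b_form :: "plane set \<Rightarrow> vector_field \<Rightarrow> scalar_field \<Rightarrow> real" where
  "b_form \<Omega> u q = - (\<integral>x. q x * (\<Sum>i\<in>UNIV. D \<Omega> i i u x) \<partial>lebesgue_on \<Omega>)"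

definition c_form :: "plane set \<Rightarrow> vector_field \<Rightarrow> vector_field \<Rightarrow> vector_field \<Rightarrow> real" where
  "c_form \<Omega> u w v =
     (\<integral>x. (\<Sum>i\<in>UNIV. \<Sum>j\<in>UNIV. u x $ j * D \<Omega> j i w x * v x $ i) \<partial>lebesgue_on \<Omega>)"

text \<open>
  For \<open>u\<close>, \<open>v\<close> in \<open>L\<^sup>2(\<Theta>; H\<^sup>1\<^sub>0)\<close> the random variable \<open>c(u, u, v)\<close> need not be integrable. The
  momentum equation asserts an identity between expectations and hence that they exist; as
  non-integrable functions have integral \<open>0\<close> here, this has to be said explicitly.
\<close>

definition has_expectation :: "'t measure \<Rightarrow> ('t \<Rightarrow> real) \<Rightarrow> real \<Rightarrow> bool" where
  "has_expectation M X e \<longleftrightarrow> integrable M X \<and> prob_space.expectation M X = e"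

definition divergence_free :: "'t measure \<Rightarrow> plane set \<Rightarrow> ('t \<Rightarrow> vector_field) \<Rightarrow> bool" where
  "divergence_free M \<Omega> u \<longleftrightarrow> (\<forall>q \<in> W\<^sub>0 M \<Omega>. has_expectation M (\<lambda>\<theta>. b_form \<Omega> (u \<theta>) (q \<theta>)) 0)"

text \<open>
  In the following three definitions \<open>F\<close> is the deterministic force and \<open>S\<close> is the random forcing
  \<open>\<sigma> dW/dx\<close>.
\<close>

definition solves_A ::
    "'t measure \<Rightarrow> plane set \<Rightarrow> real \<Rightarrow> (vector_field \<Rightarrow> real) \<Rightarrow> ('t \<Rightarrow> vector_field \<Rightarrow> real) \<Rightarrow>
     ('t \<Rightarrow> vector_field) \<Rightarrow> ('t \<Rightarrow> scalar_field) \<Rightarrow> bool" where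
  "solves_A M \<Omega> \<nu> F S u p \<longleftrightarrow> u \<in> V\<^sub>0 M \<Omega> \<and> p \<in> W\<^sub>0 M \<Omega> \<and>
     (\<forall>v \<in> V\<^sub>0 M \<Omega>. has_expectation M
        (\<lambda>\<theta>. a_form \<Omega> \<nu> (u \<theta>) (v \<theta>) + c_form \<Omega> (u \<theta>) (u \<theta>) (v \<theta>) + b_form \<Omega> (v \<theta>) (p \<theta>))
        (prob_space.expectation M (\<lambda>\<theta>. F (v \<theta>) + S \<theta> (v \<theta>)))) \<and>
     divergence_free M \<Omega> u"

definition solves_B ::
    "'t measure \<Rightarrow> plane set \<Rightarrow> real \<Rightarrow> (vector_field \<Rightarrow> real) \<Rightarrow>
     vector_field \<Rightarrow> ('t \<Rightarrow> scalar_field) \<Rightarrow> bool" where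
  "solves_B M \<Omega> \<nu> F \<xi> p\<^sub>1 \<longleftrightarrow> \<xi> \<in> vH1_0 \<Omega> \<and> p\<^sub>1 \<in> W\<^sub>0 M \<Omega> \<and>
     (\<forall>v \<in> V\<^sub>0 M \<Omega>. has_expectation M
        (\<lambda>\<theta>. a_form \<Omega> \<nu> \<xi> (v \<theta>) + c_form \<Omega> \<xi> \<xi> (v \<theta>) + b_form \<Omega> (v \<theta>) (p\<^sub>1 \<theta>))
        (prob_space.expectation M (\<lambda>\<theta>. F (v \<theta>)))) \<and>
     divergence_free M \<Omega> (\<lambda>_. \<xi>)"

definition solves_C ::
    "'t measure \<Rightarrow> plane set \<Rightarrow> real \<Rightarrow> vector_field \<Rightarrow> ('t \<Rightarrow> vector_field \<Rightarrow> real) \<Rightarrow>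
     ('t \<Rightarrow> vector_field) \<Rightarrow> ('t \<Rightarrow> scalar_field) \<Rightarrow> bool" where
  "solves_C M \<Omega> \<nu> \<xi> S \<eta> p\<^sub>2 \<longleftrightarrow> \<eta> \<in> V\<^sub>0 M \<Omega> \<and> p\<^sub>2 \<in> W\<^sub>0 M \<Omega> \<and>
     (\<forall>v \<in> V\<^sub>0 M \<Omega>. has_expectation M
        (\<lambda>\<theta>. a_form \<Omega> \<nu> (\<eta> \<theta>) (v \<theta>) + c_form \<Omega> (\<eta> \<theta>) (\<eta> \<theta>) (v \<theta>)
             + c_form \<Omega> (\<eta> \<theta>) \<xi> (v \<theta>) + c_form \<Omega> \<xi> (\<eta> \<theta>) (v \<theta>) + b_form \<Omega> (v \<theta>) (p\<^sub>2 \<theta>))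
        (prob_space.expectation M (\<lambda>\<theta>. S \<theta> (v \<theta>)))) \<and>
     divergence_free M \<Omega> \<eta>"

end

theory Submission
  imports Defs
begin

text \<open>
  For \<open>u = \<xi> + \<eta>\<close> the bilinearity of \<open>a\<close> and \<open>b\<close> and the expansion
  \<open>c(u, u, v) = c(\<xi>, \<xi>, v) + (c(\<eta>, \<eta>, v) + c(\<eta>, \<xi>, v) + c(\<xi>, \<eta>, v))\<close> show that the momentum
  equation (A) is the sum of (B) and (C) if the pressures satisfy \<open>p = p\<^sub>1 + p\<^sub>2\<close>. So (A) follows
  from (B) and (C) with the pressure \<open>p\<^sub>1 + p\<^sub>2\<close>, and (C) follows from (A) and (B) with the pressure
  \<open>p - p\<^sub>1\<close>. The analytic content is that all terms into which a term is split are integrable, and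
  that the velocities and the pressures indeed form linear spaces.

  Weak derivatives are chosen arbitrarily, hence additive only almost everywhere and only because
  they are unique almost everywhere. Uniqueness is the fundamental lemma of the calculus of
  variations (\<open>fundamental_lemma_calculus_of_variations\<close>), for which smooth bumps converging to
  indicators of boxes are constructed from \<open>exp (- 1 / t)\<close>.

  The convective form involves products of three functions. They are integrable since functions in
  \<open>H\<^sup>1\<^sub>0\<close> of a planar domain are in \<open>L\<^sup>4\<close> (\<open>H1_0_power4_integrable\<close>), by the Ladyzhenskaya
  inequality for test functions (\<open>Ladyzhenskaya_test_function\<close>) and density.

  Finally, the expectation of the total force splits into the deterministic and the random part
  because both pairings are integrable: they are limits of simple random variables, and bounded by
  the product of the dual norm and the norm (\<open>random_forcing_pairing_integrable\<close>).
\<close>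

section \<open>Smooth functions with compact support\<close>

lemma C_k_lower: "C_k (Suc k) f \<Longrightarrow> C_k k f"
proof (induction k arbitrary: f)
  case 0
  then show ?case
    by (auto intro!: differentiable_imp_continuous_on simp: differentiable_on_def
        intro: differentiable_at_withinI)
next
  case (Suc k)
  then have "C_k (Suc k) (pderiv_at j f)" for j by simp
  then have "C_k k (pderiv_at j f)" for j by (rule Suc.IH)
  with Suc.prems show ?case by simp
qed

lemma C_k_continuous: "C_k k f \<Longrightarrow> continuous_on UNIV f"
proof (induction k)
  case (Suc k)
  then show ?case using C_k_lower[OF Suc.prems] by simp
qed simp

lemma has_derivative_imp_pderiv_at:
  "(f has_derivative f') (at x) \<Longrightarrow> pderiv_at j f x = f' (axis j 1)"
  unfolding pderiv_at_def using frechet_derivative_at by metis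

lemma pderiv_at_add:
  assumes "f differentiable (at x)" "g differentiable (at x)"
  shows "pderiv_at j (\<lambda>x. f x + g x) x = pderiv_at j f x + pderiv_at j g x"
  using has_derivative_imp_pderiv_at[OF has_derivative_add[OF assms[unfolded frechet_derivative_works]]]
  by (simp add: pderiv_at_def)

lemma pderiv_at_mult:
  assumes "f differentiable (at x)" "g differentiable (at x)"
  shows "pderiv_at j (\<lambda>x. f x * g x) x = f x * pderiv_at j g x + pderiv_at j f x * g x"
  using has_derivative_imp_pderiv_at[OF has_derivative_mult[OF assms[unfolded frechet_derivative_works]]]
  by (simp add: pderiv_at_def)

lemma C_k_add: "C_k k f \<Longrightarrow> C_k k g \<Longrightarrow> C_k k (\<lambda>x. f x + g x)"
proof (induction k arbitrary: f g)
  case (Suc k)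
  then have "pderiv_at j (\<lambda>x. f x + g x) = (\<lambda>x. pderiv_at j f x + pderiv_at j g x)" for j
    by (intro ext pderiv_at_add) auto
  with Suc show ?case by auto
qed (auto intro: continuous_intros)

lemma C_k_mult: "C_k k f \<Longrightarrow> C_k k g \<Longrightarrow> C_k k (\<lambda>x. f x * g x)"
proof (induction k arbitrary: f g)
  case (Suc k)
  then have d: "\<forall>x. f differentiable (at x)" "\<forall>x. g differentiable (at x)"
    and p: "\<And>j. C_k k (pderiv_at j f)" "\<And>j. C_k k (pderiv_at j g)"
    by auto
  have "pderiv_at j (\<lambda>x. f x * g x) = (\<lambda>x. f x * pderiv_at j g x + pderiv_at j f x * g x)" for j
    using d by (intro ext pderiv_at_mult) auto
  moreover have "C_k k (\<lambda>x. f x * pderiv_at j g x + pderiv_at j f x * g x)" for j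
    by (rule C_k_add; rule Suc.IH) (rule p C_k_lower[OF Suc.prems(1)] C_k_lower[OF Suc.prems(2)])+
  ultimately show ?case
    using d by simp
qed (auto intro: continuous_intros)

lemma C_k_const: "C_k k (\<lambda>x. r)"
proof (induction k arbitrary: r)
  case (Suc k)
  have "pderiv_at j (\<lambda>x. r) = (\<lambda>x. 0)" for j
    by (auto simp: pderiv_at_def)
  with Suc show ?case by simp
qed auto

lemma C_k_prod: "finite I \<Longrightarrow> (\<And>i. i \<in> I \<Longrightarrow> C_k k (f i)) \<Longrightarrow> C_k k (\<lambda>x. \<Prod>i\<in>I. f i x)"
  by (induction I rule: finite_induct) (auto intro: C_k_const C_k_mult)

text \<open>
  For \<open>t > 0\<close> the flat function \<open>exp (- 1 / t)\<close> and all its derivatives are of the form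
  \<open>P (1 / t) * exp (- 1 / t)\<close> with a polynomial \<open>P\<close>; working with this whole family makes
  the induction over the order of differentiation immediate.
\<close>
definition flat :: "real poly \<Rightarrow> real \<Rightarrow> real" where
  "flat P t = (if t > 0 then poly P (inverse t) * exp (- inverse t) else 0)"

definition flat_deriv :: "real poly \<Rightarrow> real poly" where
  "flat_deriv P = [:0, 0, 1:] * (P - pderiv P)"

lemma poly_over_exp_tendsto_0: "((\<lambda>s::real. poly P s * exp (- s)) \<longlongrightarrow> 0) at_top"
proof -
  have "((\<lambda>s. \<Sum>i\<le>degree P. coeff P i * (s ^ i / exp s)) \<longlongrightarrow> (\<Sum>i\<le>degree P. coeff P i * 0)) at_top"
    by (intro tendsto_intros tendsto_power_div_exp_0)
  then show ?thesis
    by (simp add: poly_altdef exp_minus sum_distrib_right divide_inverse mult.assoc)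
qed

text \<open>
  At \<open>t = 0\<close> the difference quotient from the right is \<open>s * P s * exp (- s)\<close> at \<open>s = 1 / t\<close>, and
  the exponential beats every polynomial as \<open>s\<close> tends to infinity.
\<close>
lemma flat_has_derivative: "(flat P has_real_derivative flat (flat_deriv P) t) (at t)"
proof -
  consider "t > 0" | "t < 0" | "t = 0" by linarith
  then show ?thesis
  proof cases
    case 1
    have "((\<lambda>t. poly P (inverse t) * exp (- inverse t)) has_real_derivative
             poly (flat_deriv P) (inverse t) * exp (- inverse t)) (at t)"
      using 1 by (auto intro!: derivative_eq_intros simp: flat_deriv_def power2_eq_square algebra_simps)
    moreover have "eventually (\<lambda>s. poly P (inverse s) * exp (- inverse s) = flat P s) (nhds t)"
      using eventually_nhds_in_open[of "{0<..}" t] 1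
      by (auto elim!: eventually_mono simp: flat_def)
    ultimately show ?thesis
      using 1 by (subst (asm) DERIV_cong_ev[OF refl _ refl]) (auto simp: flat_def)
  next
    case 2
    have "eventually (\<lambda>s. 0 = flat P s) (nhds t)"
      using eventually_nhds_in_open[of "{..<0}" t] 2
      by (auto elim!: eventually_mono simp: flat_def)
    then have "((\<lambda>_. 0) has_real_derivative 0) (at t) = (flat P has_real_derivative 0) (at t)"
      by (intro DERIV_cong_ev) auto
    then show ?thesis
      using 2 by (auto simp: flat_def)
  next
    case 3
    have "((\<lambda>s. poly ([:0, 1:] * P) (inverse s) * exp (- inverse s)) \<longlongrightarrow> 0) (at_right 0)"
      by (rule filterlim_compose[OF poly_over_exp_tendsto_0 filterlim_inverse_at_top_right])
    then have "((\<lambda>s. flat P s / s) \<longlongrightarrow> 0) (at_right 0)"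
      by (rule Lim_transform_eventually)
        (auto simp: eventually_at_right_less flat_def field_simps intro!: eventually_mono[OF eventually_at_right_less[of 0]])
    moreover have "((\<lambda>s. flat P s / s) \<longlongrightarrow> 0) (at_left 0)"
      by (rule Lim_transform_eventually[OF tendsto_const])
        (auto simp: flat_def eventually_at_filter)
    ultimately show ?thesis
      using 3 by (auto simp: has_field_derivative_iff filterlim_at_split flat_def)
  qed
qed

lemma C_k_flat: "C_k k (\<lambda>x. flat P (r * x $ i + s))"
proof (induction k arbitrary: P)
  case 0
  have "continuous_on UNIV (flat P)"
    by (auto intro!: continuous_at_imp_continuous_on DERIV_isCont flat_has_derivative)
  then show ?case
    by (auto intro!: continuous_on_compose2[of UNIV "flat P"] continuous_intros)
next
  case (Suc k)
  have *: "((\<lambda>x. flat P (r * x $ i + s)) has_derivative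
           (\<lambda>h. flat (flat_deriv P) (r * x $ i + s) * (r * h $ i))) (at x)" for x :: plane
  proof -
    have "(flat P has_derivative (*) (flat (flat_deriv P) (r * x $ i + s))) (at (r * x $ i + s))"
      using flat_has_derivative by (simp add: has_field_derivative_def)
    moreover have "((\<lambda>x. r * x $ i + s) has_derivative (\<lambda>h. r * h $ i)) (at x)"
      by (auto intro!: derivative_eq_intros bounded_linear.has_derivative[OF bounded_linear_vec_nth])
    ultimately show ?thesis
      by (rule has_derivative_compose[rotated])
  qed
  have "pderiv_at j (\<lambda>x. flat P (r * x $ i + s)) =
        (\<lambda>x. (r * axis j 1 $ i) * flat (flat_deriv P) (r * x $ i + s))" for j
    using has_derivative_imp_pderiv_at[OF *] by (auto simp: mult_ac)
  moreover have "C_k k (\<lambda>x. (r * axis j 1 $ i) * flat (flat_deriv P) (r * x $ i + s))" for j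
    by (rule C_k_mult[OF C_k_const Suc.IH])
  moreover have "(\<lambda>x. flat P (r * x $ i + s)) differentiable (at x)" for x :: plane
    using * by (rule differentiableI)
  ultimately show ?case by simp
qed

text \<open>
  Since \<open>flat 1 (k * t)\<close> tends to the indicator of \<open>t > 0\<close> as \<open>k\<close> grows, these bumps converge to
  the indicator of the open box; the factor \<open>Suc n\<close> keeps each of them positive on the whole box.
\<close>
definition box_bump :: "plane \<Rightarrow> plane \<Rightarrow> nat \<Rightarrow> scalar_field" where
  "box_bump a b n x =
     (\<Prod>i\<in>UNIV. flat 1 (real (Suc n) * x $ i + (- real (Suc n) * a $ i)) *
               flat 1 (- real (Suc n) * x $ i + real (Suc n) * b $ i))"

lemma flat_1_bounds: "0 \<le> flat 1 t" "flat 1 t \<le> 1"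
  by (auto simp: flat_def)

lemma box_bump_bounds: "0 \<le> box_bump a b n x" "box_bump a b n x \<le> 1"
  unfolding box_bump_def
  by (auto intro!: prod_nonneg prod_le_1 mult_nonneg_nonneg mult_le_one flat_1_bounds)

lemma box_bump_nonzero_iff: "box_bump a b n x \<noteq> 0 \<longleftrightarrow> x \<in> box a b"
proof -
  have "0 < real (Suc n) * s + (- real (Suc n) * t) \<longleftrightarrow> t < s"
       "0 < - real (Suc n) * s + real (Suc n) * t \<longleftrightarrow> s < t" for s t
    using mult_less_cancel_left_pos[of "real (Suc n)"] by (simp_all add: algebra_simps)
  then show ?thesis
    by (auto simp: box_bump_def mem_box_cart flat_def)
qed

lemma box_bump_tendsto: "(\<lambda>n. box_bump a b n x) \<longlonglongrightarrow> indicator (box a b) x"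
proof (cases "x \<in> box a b")
  case True
  have *: "(\<lambda>n. flat 1 (real (Suc n) * t)) \<longlonglongrightarrow> 1" if "t > 0" for t
  proof -
    have "(\<lambda>n. exp (- (inverse (real (Suc n)) * inverse t))) \<longlonglongrightarrow> exp (- (0 * inverse t))"
      by (intro tendsto_intros LIMSEQ_inverse_real_of_nat)
    then show ?thesis
      using that by (simp add: flat_def)
  qed
  have "(\<lambda>n. box_bump a b n x) \<longlonglongrightarrow> (\<Prod>i\<in>(UNIV::2 set). 1 * 1)"
    unfolding box_bump_def
  proof (intro tendsto_prod tendsto_mult)
    fix i :: 2
    show "(\<lambda>n. flat 1 (real (Suc n) * x $ i + (- real (Suc n) * a $ i))) \<longlonglongrightarrow> 1"
      using *[of "x $ i - a $ i"] True by (simp add: mem_box_cart algebra_simps)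
    show "(\<lambda>n. flat 1 (- real (Suc n) * x $ i + real (Suc n) * b $ i)) \<longlonglongrightarrow> 1"
      using *[of "b $ i - x $ i"] True by (simp add: mem_box_cart algebra_simps)
  qed
  with True show ?thesis by simp
next
  case False
  then have "box_bump a b n x = 0" for n
    using box_bump_nonzero_iff by blast
  with False show ?thesis by simp
qed

lemma box_bump_C_k: "C_k k (box_bump a b n)"
  unfolding box_bump_def[abs_def]
  by (rule C_k_prod[OF finite], rule C_k_mult; rule C_k_flat)

text \<open>Any compact superset of the support will do, so that no closure has to be computed.\<close>
lemma test_functionsI:
  assumes "\<And>k. C_k k \<phi>" "compact K" "K \<subseteq> \<Omega>" "\<And>x. x \<notin> K \<Longrightarrow> \<phi> x = 0"
  shows "\<phi> \<in> test_functions \<Omega>"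
proof -
  have "closure {x. \<phi> x \<noteq> 0} \<subseteq> K"
    using assms by (intro closure_minimal compact_imp_closed) auto
  moreover from this have "compact (closure {x. \<phi> x \<noteq> 0})"
    using assms(2) by (metis closed_Int_compact closed_closure inf.orderE inf.commute)
  ultimately show ?thesis
    using assms by (auto simp: test_functions_def)
qed

lemma test_functionsE:
  assumes "\<phi> \<in> test_functions \<Omega>"
  obtains K where "compact K" "K \<subseteq> \<Omega>" "\<And>x. x \<notin> K \<Longrightarrow> \<phi> x = 0" "\<And>x j. x \<notin> K \<Longrightarrow> pderiv_at j \<phi> x = 0"
proof
  let ?K = "closure {x. \<phi> x \<noteq> 0}"
  show "compact ?K" "?K \<subseteq> \<Omega>" using assms by (auto simp: test_functions_def)
  show 0: "\<phi> x = 0" if "x \<notin> ?K" for x using that closure_subset[of "{x. \<phi> x \<noteq> 0}"] by auto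
  show "pderiv_at j \<phi> x = 0" if "x \<notin> ?K" for x j
  proof -
    have "(\<phi> has_derivative (\<lambda>h. 0)) (at x)"
    proof (rule has_derivative_transform_within_open)
      show "((\<lambda>x. 0) has_derivative (\<lambda>h. 0)) (at x)" by simp
      show "open (- ?K)" by (intro open_Compl closed_closure)
      show "x \<in> - ?K" using that by simp
      show "0 = \<phi> y" if "y \<in> - ?K" for y using 0[of y] that by simp
    qed
    then show ?thesis by (rule has_derivative_imp_pderiv_at)
  qed
qed

lemma test_functions_zero_outside: "\<phi> \<in> test_functions \<Omega> \<Longrightarrow> x \<notin> \<Omega> \<Longrightarrow> \<phi> x = 0"
  using closure_subset[of "{x. \<phi> x \<noteq> 0}"] by (auto simp: test_functions_def)

lemma test_functions_C_k: "\<phi> \<in> test_functions \<Omega> \<Longrightarrow> C_k k \<phi>"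
  by (simp add: test_functions_def)

lemma test_functions_differentiable: "\<phi> \<in> test_functions \<Omega> \<Longrightarrow> \<phi> differentiable (at x)"
  using test_functions_C_k[of \<phi> \<Omega> "Suc 0"] by simp

lemma test_functions_pderiv:
  assumes "\<phi> \<in> test_functions \<Omega>" shows "pderiv_at j \<phi> \<in> test_functions \<Omega>"
proof -
  obtain K where "compact K" "K \<subseteq> \<Omega>" "\<And>x j. x \<notin> K \<Longrightarrow> pderiv_at j \<phi> x = 0"
    using assms by (rule test_functionsE) blast
  moreover have "C_k k (pderiv_at j \<phi>)" for k
    using test_functions_C_k[OF assms, of "Suc k"] by simp
  ultimately show ?thesis by (intro test_functionsI)
qed

lemma test_functions_mult:
  assumes "\<phi> \<in> test_functions \<Omega>" "\<And>k. C_k k \<psi>" shows "(\<lambda>x. \<phi> x * \<psi> x) \<in> test_functions \<Omega>"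
proof -
  obtain K where "compact K" "K \<subseteq> \<Omega>" "\<And>x. x \<notin> K \<Longrightarrow> \<phi> x = 0"
    using assms(1) by (rule test_functionsE) blast
  with assms show ?thesis
    by (intro test_functionsI[of _ K]) (auto intro: C_k_mult test_functions_C_k)
qed

lemma test_functions_scale:
  "\<phi> \<in> test_functions \<Omega> \<Longrightarrow> (\<lambda>x. r * \<phi> x) \<in> test_functions \<Omega>"
  using test_functions_mult[of \<phi> \<Omega> "\<lambda>_. r"] C_k_const by (simp add: mult.commute)

lemma test_functions_add:
  assumes "\<phi> \<in> test_functions \<Omega>" "\<psi> \<in> test_functions \<Omega>"
  shows "(\<lambda>x. \<phi> x + \<psi> x) \<in> test_functions \<Omega>"
proof -
  obtain K where K: "compact K" "K \<subseteq> \<Omega>" "\<And>x. x \<notin> K \<Longrightarrow> \<phi> x = 0"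
    using assms(1) by (rule test_functionsE) blast
  obtain L where L: "compact L" "L \<subseteq> \<Omega>" "\<And>x. x \<notin> L \<Longrightarrow> \<psi> x = 0"
    using assms(2) by (rule test_functionsE) blast
  show ?thesis
    by (rule test_functionsI[of _ "K \<union> L"])
      (use K L assms in \<open>auto intro: C_k_add test_functions_C_k\<close>)
qed

lemma test_functions_continuous: "\<phi> \<in> test_functions \<Omega> \<Longrightarrow> continuous_on UNIV \<phi>"
  using test_functions_C_k C_k_continuous by blast

lemma test_functions_bounded:
  assumes "\<phi> \<in> test_functions \<Omega>" obtains B where "\<And>x. \<bar>\<phi> x\<bar> \<le> B" "B \<ge> 0"
proof -
  obtain K where K: "compact K" "K \<subseteq> \<Omega>" "\<And>x. x \<notin> K \<Longrightarrow> \<phi> x = 0"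
    using assms by (rule test_functionsE) blast
  have "compact (\<phi> ` K)"
    using test_functions_continuous[OF assms] K(1)
    by (intro compact_continuous_image) (auto intro: continuous_on_subset)
  then obtain B where "\<And>x. x \<in> K \<Longrightarrow> \<bar>\<phi> x\<bar> \<le> B"
    by (force dest: compact_imp_bounded simp: bounded_iff)
  with K(3) have "\<bar>\<phi> x\<bar> \<le> max B 0" for x by (cases "x \<in> K") (auto simp: le_max_iff_disj)
  then show ?thesis using that[of "max B 0"] by simp
qed

lemma test_functions_measurable:
  "\<phi> \<in> test_functions \<Omega> \<Longrightarrow> \<phi> \<in> borel_measurable borel"
  using borel_measurable_continuous_onI[OF test_functions_continuous] .

lemma box_bump_test:
  assumes "cbox a b \<subseteq> \<Omega>" shows "box_bump a b n \<in> test_functions \<Omega>"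
proof (rule test_functionsI[OF box_bump_C_k compact_cbox assms])
  show "box_bump a b n x = 0" if "x \<notin> cbox a b" for x
    using that box_bump_nonzero_iff[of a b n x] box_subset_cbox by blast
qed

section \<open>Integration over the plane by slices\<close>

text \<open>
  The plane consists of vectors rather than pairs, so Fubini's theorem has to be transported along
  the coordinate map; the two measures are compared on boxes.
\<close>
lemma lborel_plane:
  "distr (lborel \<Otimes>\<^sub>M lborel) borel (\<lambda>(x, y). x *\<^sub>R axis 1 1 + y *\<^sub>R axis 2 1) = (lborel :: plane measure)"
proof (rule lborel_eqI[symmetric])
  fix l u :: plane
  assume le: "\<And>b. b \<in> Basis \<Longrightarrow> l \<bullet> b \<le> u \<bullet> b"
  let ?T = "\<lambda>(x, y). x *\<^sub>R axis 1 1 + y *\<^sub>R axis 2 1 :: plane"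
  have B: "Basis = range (\<lambda>i. axis i 1 :: plane)"
    by (auto simp: Basis_vec_def)
  have le': "l $ i \<le> u $ i" for i
    using le[of "axis i 1"] by (auto simp: B inner_axis)
  have nth: "?T (x, y) $ 1 = x" "?T (x, y) $ 2 = y" for x y
    by (simp_all add: axis_def)
  have "?T -` box l u = {l $ 1<..<u $ 1} \<times> {l $ 2<..<u $ 2}"
    unfolding mem_box_cart set_eq_iff vimage_eq split_paired_all mem_Times_iff forall_2 nth
    by (auto simp: axis_def)
  moreover have "?T \<in> lborel \<Otimes>\<^sub>M lborel \<rightarrow>\<^sub>M borel"
    by measurable
  ultimately have "emeasure (distr (lborel \<Otimes>\<^sub>M lborel) borel ?T) (box l u) =
      ennreal (u $ 1 - l $ 1) * ennreal (u $ 2 - l $ 2)"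
    using le' by (simp add: emeasure_distr space_pair_measure lborel.emeasure_pair_measure_Times)
  moreover have "(\<Prod>b\<in>Basis. (u - l) \<bullet> b) = (\<Prod>i\<in>UNIV. u $ i - l $ i)"
    unfolding B by (subst prod.reindex) (auto simp: inj_on_def axis_eq_axis inner_axis)
  ultimately show "emeasure (distr (lborel \<Otimes>\<^sub>M lborel) borel ?T) (box l u) = (\<Prod>b\<in>Basis. (u - l) \<bullet> b)"
    using le' by (simp add: UNIV_2 ennreal_mult)
qed simp

lemma
  fixes f :: "plane \<Rightarrow> ennreal"
  assumes [measurable]: "f \<in> borel_measurable borel"
  shows nn_integral_plane_xy:
      "(\<integral>\<^sup>+z. f z \<partial>lborel) = (\<integral>\<^sup>+x. \<integral>\<^sup>+y. f (x *\<^sub>R axis 1 1 + y *\<^sub>R axis 2 1) \<partial>lborel \<partial>lborel)"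
    and nn_integral_plane_yx:
      "(\<integral>\<^sup>+z. f z \<partial>lborel) = (\<integral>\<^sup>+y. \<integral>\<^sup>+x. f (x *\<^sub>R axis 1 1 + y *\<^sub>R axis 2 1) \<partial>lborel \<partial>lborel)"
proof -
  let ?g = "\<lambda>(x, y). f (x *\<^sub>R axis 1 1 + y *\<^sub>R axis 2 1)"
  have *: "(\<integral>\<^sup>+z. f z \<partial>lborel) = (\<integral>\<^sup>+p. ?g p \<partial>(lborel \<Otimes>\<^sub>M lborel))"
    by (subst lborel_plane[symmetric], subst nn_integral_distr) (auto intro!: nn_integral_cong)
  show "(\<integral>\<^sup>+z. f z \<partial>lborel) = (\<integral>\<^sup>+x. \<integral>\<^sup>+y. f (x *\<^sub>R axis 1 1 + y *\<^sub>R axis 2 1) \<partial>lborel \<partial>lborel)"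
    unfolding * by (subst lborel.nn_integral_fst[symmetric]) auto
  show "(\<integral>\<^sup>+z. f z \<partial>lborel) = (\<integral>\<^sup>+y. \<integral>\<^sup>+x. f (x *\<^sub>R axis 1 1 + y *\<^sub>R axis 2 1) \<partial>lborel \<partial>lborel)"
    unfolding * by (subst lborel_pair.nn_integral_snd[symmetric]) auto
qed

lemma
  fixes f :: "plane \<Rightarrow> real"
  assumes int: "integrable lborel f"
  shows integral_plane_xy:
      "(\<integral>z. f z \<partial>lborel) = (\<integral>x. \<integral>y. f (x *\<^sub>R axis 1 1 + y *\<^sub>R axis 2 1) \<partial>lborel \<partial>lborel)"
    and integral_plane_yx:
      "(\<integral>z. f z \<partial>lborel) = (\<integral>y. \<integral>x. f (x *\<^sub>R axis 1 1 + y *\<^sub>R axis 2 1) \<partial>lborel \<partial>lborel)"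
proof -
  let ?T = "\<lambda>(x, y). x *\<^sub>R axis 1 1 + y *\<^sub>R axis 2 1 :: plane"
  let ?g = "\<lambda>(x, y). f (x *\<^sub>R axis 1 1 + y *\<^sub>R axis 2 1)"
  have [measurable]: "f \<in> borel_measurable borel" using int by simp
  have g: "?g = f \<circ> ?T" by auto
  have T: "?T \<in> lborel \<Otimes>\<^sub>M lborel \<rightarrow>\<^sub>M borel" by measurable
  have *: "(\<integral>z. f z \<partial>lborel) = (\<integral>p. ?g p \<partial>(lborel \<Otimes>\<^sub>M lborel))"
    unfolding g by (subst lborel_plane[symmetric], subst integral_distr[OF T]) (auto simp: o_def)
  have int': "integrable (lborel \<Otimes>\<^sub>M lborel) ?g"
    using int unfolding g
    by (subst (asm) lborel_plane[symmetric], subst (asm) integrable_distr_eq[OF T]) (auto simp: o_def)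
  show "(\<integral>z. f z \<partial>lborel) = (\<integral>x. \<integral>y. f (x *\<^sub>R axis 1 1 + y *\<^sub>R axis 2 1) \<partial>lborel \<partial>lborel)"
    unfolding * using lborel_pair.integral_fst'[OF int'] by simp
  show "(\<integral>z. f z \<partial>lborel) = (\<integral>y. \<integral>x. f (x *\<^sub>R axis 1 1 + y *\<^sub>R axis 2 1) \<partial>lborel \<partial>lborel)"
    unfolding * using lborel_pair.integral_snd[of "\<lambda>x y. f (x *\<^sub>R axis 1 1 + y *\<^sub>R axis 2 1)"] int' by simp
qed

lemma integral_deriv_compact_support:
  fixes g :: "real \<Rightarrow> real"
  assumes "\<And>t. (g has_real_derivative g' t) (at t)" "continuous_on UNIV g'"
    and "\<And>t. \<bar>t\<bar> \<ge> R \<Longrightarrow> g t = 0" "\<And>t. \<bar>t\<bar> \<ge> R \<Longrightarrow> g' t = 0" "R \<ge> 0"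
  shows "(\<integral>t. g' t \<partial>lborel) = 0"
proof -
  have *: "g' t * indicator {-R..R} t = g' t" for t
    using assms(4)[of t] by (cases "\<bar>t\<bar> \<ge> R") (auto simp: indicator_def)
  have "(\<integral>t. g' t \<partial>lborel) = (\<integral>t. g' t * indicator {-R..R} t \<partial>lborel)"
    by (simp only: *)
  also have "\<dots> = g R - g (- R)"
    by (rule integral_FTC_Icc_real) (use assms in \<open>auto simp: continuous_on_eq_continuous_at\<close>)
  finally show ?thesis using assms by simp
qed

lemma compact_support_le_nn_integral_deriv:
  fixes g :: "real \<Rightarrow> real"
  assumes "\<And>t. (g has_real_derivative g' t) (at t)" "continuous_on UNIV g'"
    and "\<And>t. \<bar>t\<bar> \<ge> R \<Longrightarrow> g t = 0"
  shows "ennreal (g s) \<le> (\<integral>\<^sup>+t. ennreal \<bar>g' t\<bar> \<partial>lborel)"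
proof (cases "\<bar>s\<bar> \<ge> R")
  case False
  have *: "has_bochner_integral lborel (\<lambda>t. g' t * indicator {-R..s} t) (g s - g (- R))"
    by (rule has_bochner_integral_FTC_Icc_real)
      (use assms False in \<open>auto simp: continuous_on_eq_continuous_at\<close>)
  moreover have "g (- R) = 0" using False assms(3)[of "-R"] by auto
  ultimately have "g s = (\<integral>t. g' t * indicator {-R..s} t \<partial>lborel)"
    by (simp add: has_bochner_integral_iff)
  then have "ennreal (g s) \<le> ennreal (norm (\<integral>t. g' t * indicator {-R..s} t \<partial>lborel))"
    by (intro ennreal_leI) simp
  also have "\<dots> \<le> (\<integral>\<^sup>+t. norm (g' t * indicator {-R..s} t) \<partial>lborel)"
    using * by (intro integral_norm_bound_ennreal) (auto simp: has_bochner_integral_iff)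
  also have "\<dots> \<le> (\<integral>\<^sup>+t. ennreal \<bar>g' t\<bar> \<partial>lborel)"
    by (intro nn_integral_mono ennreal_leI) (auto simp: indicator_def)
  finally show ?thesis .
qed (use assms in auto)

lemma test_function_slice_derivative:
  assumes "\<phi> \<in> test_functions \<Omega>"
  shows "((\<lambda>t. \<phi> (z + t *\<^sub>R axis j 1)) has_real_derivative pderiv_at j \<phi> (z + t *\<^sub>R axis j 1)) (at t)"
proof -
  let ?z = "z + t *\<^sub>R axis j 1"
  have d: "(\<phi> has_derivative frechet_derivative \<phi> (at ?z)) (at ?z)"
    using test_functions_differentiable[OF assms] by (simp add: frechet_derivative_works)
  have "((\<lambda>t. z + t *\<^sub>R axis j 1) has_derivative (\<lambda>h. h *\<^sub>R axis j 1)) (at t)"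
    by (auto intro!: derivative_eq_intros)
  then have "((\<lambda>t. \<phi> (z + t *\<^sub>R axis j 1)) has_derivative
      (\<lambda>h. frechet_derivative \<phi> (at ?z) (h *\<^sub>R axis j 1))) (at t)"
    by (rule has_derivative_compose) (use d in simp)
  then show ?thesis
    using linear_scale[OF has_derivative_linear[OF d]]
    by (simp add: has_field_derivative_def pderiv_at_def mult.commute[of _ "frechet_derivative _ _ _"])
qed

lemma test_function_slice_support:
  assumes "\<phi> \<in> test_functions \<Omega>"
  obtains R where "R \<ge> 0"
    "\<And>z j t. z $ j = 0 \<Longrightarrow> \<bar>t\<bar> \<ge> R \<Longrightarrow> \<phi> (z + t *\<^sub>R axis j 1) = 0"
    "\<And>z j i t. z $ j = 0 \<Longrightarrow> \<bar>t\<bar> \<ge> R \<Longrightarrow> pderiv_at i \<phi> (z + t *\<^sub>R axis j 1) = 0"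
proof -
  obtain K where K: "compact K" "\<And>x. x \<notin> K \<Longrightarrow> \<phi> x = 0" "\<And>x j. x \<notin> K \<Longrightarrow> pderiv_at j \<phi> x = 0"
    using assms by (rule test_functionsE) blast
  then obtain B where B: "\<And>x. x \<in> K \<Longrightarrow> norm x \<le> B" "B > 0"
    by (meson bounded_pos compact_imp_bounded)
  have *: "z + t *\<^sub>R axis j 1 \<notin> K" if "z $ j = 0" "\<bar>t\<bar> \<ge> B + 1" for z t j
  proof
    assume "z + t *\<^sub>R axis j 1 \<in> K"
    moreover have "\<bar>t\<bar> \<le> norm (z + t *\<^sub>R axis j 1)"
      using component_le_norm_cart[of "z + t *\<^sub>R axis j 1" j] that by (simp add: axis_def)
    ultimately show False using B that by fastforce
  qed
  show ?thesis
    by (rule that[of "B + 1"]) (use * K B in auto)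
qed

lemma test_function_integrable:
  assumes "\<phi> \<in> test_functions \<Omega>" shows "integrable lborel \<phi>"
proof -
  obtain K where K: "compact K" "K \<subseteq> \<Omega>" "\<And>x. x \<notin> K \<Longrightarrow> \<phi> x = 0"
    using assms by (rule test_functionsE) blast
  have "integrable lborel (\<lambda>x. indicator K x *\<^sub>R \<phi> x)"
    using K test_functions_continuous[OF assms]
    by (intro borel_integrable_compact) (auto intro: continuous_on_subset)
  also have "(\<lambda>x. indicator K x *\<^sub>R \<phi> x) = \<phi>"
    using K(3) by (auto simp: indicator_def fun_eq_iff)
  finally show ?thesis .
qed

text \<open>
  Integrating first along the lines in direction \<open>j\<close> reduces the claim to the fundamental theorem
  of calculus for a compactly supported function on the line.
\<close>
lemma integral_pderiv_test_function:
  assumes "\<phi> \<in> test_functions \<Omega>" shows "(\<integral>z. pderiv_at j \<phi> z \<partial>lborel) = 0"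
proof -
  obtain R where R: "R \<ge> 0"
    "\<And>z j t. z $ j = 0 \<Longrightarrow> \<bar>t\<bar> \<ge> R \<Longrightarrow> \<phi> (z + t *\<^sub>R axis j 1) = 0"
    "\<And>z j i t. z $ j = 0 \<Longrightarrow> \<bar>t\<bar> \<ge> R \<Longrightarrow> pderiv_at i \<phi> (z + t *\<^sub>R axis j 1) = 0"
    using assms by (rule test_function_slice_support) blast
  have c: "continuous_on UNIV (\<lambda>t. pderiv_at j \<phi> (z + t *\<^sub>R axis j 1))" for z
    by (rule continuous_on_compose2[OF test_functions_continuous[OF test_functions_pderiv[OF assms]]])
      (auto intro!: continuous_intros)
  have slice: "(\<integral>t. pderiv_at j \<phi> (z + t *\<^sub>R axis j 1) \<partial>lborel) = 0" if "z $ j = 0" for z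
    by (rule integral_deriv_compact_support[where g = "\<lambda>t. \<phi> (z + t *\<^sub>R axis j 1)",
          OF test_function_slice_derivative[OF assms] c])
      (use R that in auto)
  note int = test_function_integrable[OF test_functions_pderiv[OF assms]]
  consider "j = 1" | "j = 2" using exhaust_2 by blast
  then show ?thesis
  proof cases
    case 1
    with slice[of "y *\<^sub>R axis 2 1" for y] show ?thesis
      by (subst integral_plane_yx[OF int]) (simp add: axis_def[of 2] add.commute)
  next
    case 2
    with slice[of "x *\<^sub>R axis 1 1" for x] show ?thesis
      by (subst integral_plane_xy[OF int]) (simp add: axis_def[of 1])
  qed
qed

lemma test_function_sq_le_slice:
  assumes "\<phi> \<in> test_functions \<Omega>" "z $ j = 0"
  shows "ennreal ((\<phi> (z + t *\<^sub>R axis j 1))\<^sup>2) \<le>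
    (\<integral>\<^sup>+s. ennreal \<bar>2 * \<phi> (z + s *\<^sub>R axis j 1) * pderiv_at j \<phi> (z + s *\<^sub>R axis j 1)\<bar> \<partial>lborel)"
proof -
  obtain R where R: "\<And>z j t. z $ j = 0 \<Longrightarrow> \<bar>t\<bar> \<ge> R \<Longrightarrow> \<phi> (z + t *\<^sub>R axis j 1) = 0"
    using assms(1) by (rule test_function_slice_support) blast
  have "((\<lambda>t. (\<phi> (z + t *\<^sub>R axis j 1))\<^sup>2) has_real_derivative
       2 * \<phi> (z + s *\<^sub>R axis j 1) * pderiv_at j \<phi> (z + s *\<^sub>R axis j 1)) (at s)" for s
    using test_function_slice_derivative[OF assms(1)] by (auto intro!: derivative_eq_intros)
  moreover have "continuous_on UNIV (\<lambda>s. 2 * \<phi> (z + s *\<^sub>R axis j 1) * pderiv_at j \<phi> (z + s *\<^sub>R axis j 1))"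
    by (intro continuous_intros
        continuous_on_compose2[OF test_functions_continuous[OF test_functions_pderiv[OF assms(1)]]]
        continuous_on_compose2[OF test_functions_continuous[OF assms(1)]]) auto
  ultimately show ?thesis
    by (rule compact_support_le_nn_integral_deriv) (use R assms in auto)
qed

text \<open>
  The Ladyzhenskaya inequality in its simplest form. On a horizontal or a vertical line \<open>\<phi>\<^sup>2\<close> is
  at most the integral of \<open>\<bar>2 * \<phi> * \<partial>\<phi>\<bar>\<close> along this line; in the product of the two bounds the
  variables separate, so that Tonelli's theorem bounds the integral of \<open>\<phi> ^ 4\<close>.
\<close>
lemma Ladyzhenskaya_test_function:
  assumes \<phi>: "\<phi> \<in> test_functions \<Omega>"
  shows "(\<integral>\<^sup>+z. ennreal ((\<phi> z) ^ 4) \<partial>lborel) \<le>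
    (\<integral>\<^sup>+z. ennreal ((\<phi> z)\<^sup>2 + (\<Sum>j\<in>UNIV. (pderiv_at j \<phi> z)\<^sup>2)) \<partial>lborel)\<^sup>2"
proof -
  let ?T = "\<lambda>x y. x *\<^sub>R axis 1 1 + y *\<^sub>R axis 2 1 :: plane"
  let ?N = "\<integral>\<^sup>+z. ennreal ((\<phi> z)\<^sup>2 + (\<Sum>j\<in>UNIV. (pderiv_at j \<phi> z)\<^sup>2)) \<partial>lborel"
  define f where "f j z = ennreal \<bar>2 * \<phi> z * pderiv_at j \<phi> z\<bar>" for j z
  have [measurable]: "\<phi> \<in> borel_measurable borel" "pderiv_at j \<phi> \<in> borel_measurable borel" for j
    using \<phi> test_functions_pderiv test_functions_measurable by blast+
  have [measurable]: "f j \<in> borel_measurable borel" for j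
    unfolding f_def[abs_def] by measurable
  define A where "A y = (\<integral>\<^sup>+x. f 1 (?T x y) \<partial>lborel)" for y
  define B where "B x = (\<integral>\<^sup>+y. f 2 (?T x y) \<partial>lborel)" for x
  have [measurable]: "A \<in> borel_measurable borel" "B \<in> borel_measurable borel"
    unfolding A_def[abs_def] B_def[abs_def] by measurable
  have A: "ennreal ((\<phi> (?T x y))\<^sup>2) \<le> A y" for x y
    using test_function_sq_le_slice[OF \<phi>, of "y *\<^sub>R axis 2 1" 1 x]
    by (simp add: A_def f_def add.commute axis_def[of 2])
  have B: "ennreal ((\<phi> (?T x y))\<^sup>2) \<le> B x" for x y
    using test_function_sq_le_slice[OF \<phi>, of "x *\<^sub>R axis 1 1" 2 y]
    by (simp add: B_def f_def axis_def[of 1])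
  have f_le: "(\<integral>\<^sup>+z. f j z \<partial>lborel) \<le> ?N" for j
  proof (intro nn_integral_mono, unfold f_def, intro ennreal_leI)
    fix z
    have "\<bar>2 * \<phi> z * pderiv_at j \<phi> z\<bar> \<le> (\<phi> z)\<^sup>2 + (pderiv_at j \<phi> z)\<^sup>2"
      using sum_squares_bound[of "\<bar>\<phi> z\<bar>" "\<bar>pderiv_at j \<phi> z\<bar>"] by (simp add: abs_mult)
    also have "(pderiv_at j \<phi> z)\<^sup>2 \<le> (\<Sum>j\<in>UNIV. (pderiv_at j \<phi> z)\<^sup>2)"
      by (intro member_le_sum) auto
    finally show "\<bar>2 * \<phi> z * pderiv_at j \<phi> z\<bar> \<le> (\<phi> z)\<^sup>2 + (\<Sum>j\<in>UNIV. (pderiv_at j \<phi> z)\<^sup>2)"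
      by simp
  qed
  have "(\<integral>\<^sup>+z. ennreal ((\<phi> z) ^ 4) \<partial>lborel) =
      (\<integral>\<^sup>+x. \<integral>\<^sup>+y. ennreal ((\<phi> (?T x y))\<^sup>2) * ennreal ((\<phi> (?T x y))\<^sup>2) \<partial>lborel \<partial>lborel)"
    by (subst nn_integral_plane_xy) (simp_all add: ennreal_mult[symmetric] power2_eq_square power4_eq_xxxx mult_ac)
  also have "\<dots> \<le> (\<integral>\<^sup>+x. \<integral>\<^sup>+y. B x * A y \<partial>lborel \<partial>lborel)"
    by (intro nn_integral_mono mult_mono A B) auto
  also have "\<dots> = (\<integral>\<^sup>+x. B x \<partial>lborel) * (\<integral>\<^sup>+y. A y \<partial>lborel)"
    by (simp add: nn_integral_cmult nn_integral_multc)
  also have "\<dots> = (\<integral>\<^sup>+z. f 2 z \<partial>lborel) * (\<integral>\<^sup>+z. f 1 z \<partial>lborel)"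
    unfolding A_def B_def by (simp add: nn_integral_plane_xy[of "f 2"] nn_integral_plane_yx[of "f 1"])
  also have "\<dots> \<le> ?N\<^sup>2"
    unfolding power2_eq_square[of ?N] by (intro mult_mono f_le) auto
  finally show ?thesis .
qed

section \<open>Uniqueness of weak derivatives\<close>

lemma
  fixes f :: scalar_field
  assumes "open \<Omega>" and [measurable]: "f \<in> borel_measurable borel" and "\<And>x. x \<notin> \<Omega> \<Longrightarrow> f x = 0"
  shows integral_lebesgue_on_borel: "(\<integral>x. f x \<partial>lebesgue_on \<Omega>) = (\<integral>x. f x \<partial>lborel)"
    and integrable_lebesgue_on_borel: "integrable (lebesgue_on \<Omega>) f \<longleftrightarrow> integrable lborel f"
proof -
  have *: "(\<lambda>x. indicator \<Omega> x *\<^sub>R f x) = f"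
    using assms(3) by (auto simp: indicator_def fun_eq_iff)
  have \<Omega>: "\<Omega> \<inter> space lebesgue \<in> sets lebesgue" using assms(1) by auto
  show "(\<integral>x. f x \<partial>lebesgue_on \<Omega>) = (\<integral>x. f x \<partial>lborel)"
    unfolding integral_restrict_space[OF \<Omega>] * by (simp add: integral_completion)
  show "integrable (lebesgue_on \<Omega>) f \<longleftrightarrow> integrable lborel f"
    unfolding integrable_restrict_space[OF \<Omega>] * by (simp add: integrable_completion)
qed

lemma nn_integral_lebesgue_on_borel:
  fixes f :: "plane \<Rightarrow> ennreal"
  assumes "open \<Omega>" and [measurable]: "f \<in> borel_measurable borel" and "\<And>x. x \<notin> \<Omega> \<Longrightarrow> f x = 0"
  shows "(\<integral>\<^sup>+x. f x \<partial>lebesgue_on \<Omega>) = (\<integral>\<^sup>+x. f x \<partial>lborel)"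
proof -
  have *: "(\<lambda>x. f x * indicator \<Omega> x) = f"
    using assms(3) by (auto simp: indicator_def fun_eq_iff)
  have \<Omega>: "\<Omega> \<inter> space lebesgue \<in> sets lebesgue" using assms(1) by auto
  show ?thesis
    unfolding nn_integral_restrict_space[OF \<Omega>] * by (simp add: nn_integral_completion)
qed

text \<open>
  Lebesgue measure is complete, so measurability survives modification on a null set. The weak
  derivative selected by the choice operator is only known up to such a modification.
\<close>
lemma measurable_lebesgue_on_AE_eq:
  fixes f g :: "plane \<Rightarrow> real"
  assumes "\<Omega> \<in> sets lebesgue" "f \<in> borel_measurable (lebesgue_on \<Omega>)" "AE x in lebesgue_on \<Omega>. f x = g x"
  shows "g \<in> borel_measurable (lebesgue_on \<Omega>)"
proof -
  let ?f = "\<lambda>x. if x \<in> \<Omega> then f x else 0" and ?g = "\<lambda>x. if x \<in> \<Omega> then g x else 0"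
  have f: "?f \<in> borel_measurable lebesgue"
    using assms(1,2) by (simp add: borel_measurable_if)
  have ae: "AE x in lebesgue. ?f x = ?g x"
    using assms(1,3) by (subst (asm) AE_restrict_space_iff) (auto elim!: eventually_mono)
  have "?g \<in> borel_measurable lebesgue"
  proof (rule measurableI)
    fix A :: "real set" assume A: "A \<in> sets borel"
    have "?f -` A \<inter> space lebesgue \<in> sets lebesgue"
      by (rule measurable_sets[OF f A])
    moreover have "AE x in lebesgue. x \<in> ?f -` A \<inter> space lebesgue \<longleftrightarrow> x \<in> ?g -` A \<inter> space lebesgue"
      using ae by eventually_elim auto
    ultimately show "?g -` A \<inter> space lebesgue \<in> sets lebesgue"
      using completion.in_sets_AE by blast
  qed simp
  then show ?thesis
    using assms(1) by (simp add: borel_measurable_if)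
qed

lemma integrable_L1_loc_mult_test_function:
  assumes f: "f \<in> L1_loc \<Omega>" and \<phi>: "\<phi> \<in> test_functions \<Omega>" and \<Omega>: "open \<Omega>"
  shows "integrable (lebesgue_on \<Omega>) (\<lambda>x. f x * \<phi> x)"
    "(\<integral>x. f x * \<phi> x \<partial>lebesgue_on \<Omega>) = (\<integral>x. f x * \<phi> x \<partial>lebesgue)"
proof -
  obtain K where K: "compact K" "K \<subseteq> \<Omega>" "\<And>x. x \<notin> K \<Longrightarrow> \<phi> x = 0"
    using \<phi> by (rule test_functionsE) blast
  obtain B where B: "\<And>x. \<bar>\<phi> x\<bar> \<le> B" using \<phi> by (rule test_functions_bounded) blast
  have Ks: "K \<inter> space lebesgue \<in> sets lebesgue" using K(1) by (simp add: lmeasurable_compact fmeasurableD)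
  have \<Omega>s: "\<Omega> \<inter> space lebesgue \<in> sets lebesgue" using \<Omega> by auto
  have int: "integrable lebesgue (\<lambda>x. indicator K x *\<^sub>R f x)"
    using f K unfolding L1_loc_def integrable_restrict_space[OF Ks, symmetric] by blast
  have [measurable]: "\<phi> \<in> borel_measurable lebesgue"
    using test_functions_measurable[OF \<phi>] by (simp add: measurable_completion)
  have "integrable lebesgue (\<lambda>x. B * (indicator K x *\<^sub>R f x))" using int by simp
  then have "integrable lebesgue (\<lambda>x. (indicator K x *\<^sub>R f x) * \<phi> x)"
  proof (rule Bochner_Integration.integrable_bound)
    show "AE x in lebesgue. norm ((indicator K x *\<^sub>R f x) * \<phi> x) \<le> norm (B * (indicator K x *\<^sub>R f x))"
    proof (intro AE_I2)
      fix x
      have "\<bar>\<phi> x\<bar> \<le> \<bar>B\<bar>" using B[of x] by linarith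
      then show "norm ((indicator K x *\<^sub>R f x) * \<phi> x) \<le> norm (B * (indicator K x *\<^sub>R f x))"
        by (simp add: abs_mult mult_right_mono mult.commute)
    qed
  qed (use int in measurable)
  also have "(\<lambda>x. (indicator K x *\<^sub>R f x) * \<phi> x) = (\<lambda>x. f x * \<phi> x)"
    using K(3) by (auto simp: indicator_def fun_eq_iff)
  finally have i: "integrable lebesgue (\<lambda>x. f x * \<phi> x)" .
  have *: "(\<lambda>x. indicator \<Omega> x *\<^sub>R (f x * \<phi> x)) = (\<lambda>x. f x * \<phi> x)"
    using K(2,3) by (auto simp: indicator_def fun_eq_iff)
  show "integrable (lebesgue_on \<Omega>) (\<lambda>x. f x * \<phi> x)"
    unfolding integrable_restrict_space[OF \<Omega>s] * by (rule i)
  show "(\<integral>x. f x * \<phi> x \<partial>lebesgue_on \<Omega>) = (\<integral>x. f x * \<phi> x \<partial>lebesgue)"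
    unfolding integral_restrict_space[OF \<Omega>s] * ..
qed

text \<open>
  The sets on which the integral of \<open>f\<close> vanishes are closed under complements and disjoint unions,
  provided that the integral over the whole plane vanishes. Since open boxes are closed under
  intersection and generate the Borel sets, it suffices to consider these.
\<close>
lemma AE_zero_if_box_integrals_zero:
  fixes f :: "plane \<Rightarrow> real"
  assumes f: "integrable lborel f"
    and box: "\<And>c d. (\<integral>x. indicator (box c d) x * f x \<partial>lborel) = 0"
    and UNIV: "(\<integral>x. f x \<partial>lborel) = 0"
  shows "AE x in lborel. f x = 0"
proof (rule sigma_finite_measure.density_zero[OF lborel.sigma_finite_measure_axioms f])
  fix A :: "plane set" assume "A \<in> sets lborel"
  then have A: "A \<in> sigma_sets UNIV (range (\<lambda>(a, b). box a b))"
    by (simp add: borel_eq_box)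
  have sub: "A \<in> sets lborel" if "A \<in> sigma_sets UNIV (range (\<lambda>(a, b). box a b))" for A :: "plane set"
    using that by (simp add: borel_eq_box)
  have int: "set_integrable lborel A f" if "A \<in> sets lborel" for A
    unfolding set_integrable_def using that f by (rule integrable_mult_indicator)
  have stable: "Int_stable (range (\<lambda>(a, b). box a b :: plane set))"
    by (auto simp: Int_stable_def box_Int_box)
  have pow: "range (\<lambda>(a, b). box a b :: plane set) \<subseteq> Pow UNIV"
    by simp
  show "set_lebesgue_integral lborel A f = 0"
    using stable pow A
  proof (induction A rule: sigma_sets_induct_disjoint)
    case (basic A)
    then show ?case using box by (auto simp: set_lebesgue_integral_def)
  next
    case empty
    show ?case by (simp add: set_lebesgue_integral_def)
  next
    case (compl A)
    have "set_lebesgue_integral lborel (A \<union> (UNIV - A)) f =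
        set_lebesgue_integral lborel A f + set_lebesgue_integral lborel (UNIV - A) f"
      using sub[OF compl(1)] by (intro set_integral_Un int) auto
    then show ?case using compl UNIV by (simp add: set_lebesgue_integral_def)
  next
    case (union A)
    have [measurable]: "A i \<in> sets lborel" for i using union(2) sub by blast
    have "set_lebesgue_integral lborel (\<Union>i. A i) f = (\<Sum>i. set_lebesgue_integral lborel (A i) f)"
    proof (rule lebesgue_integral_countable_add)
      show "A i \<in> sets lborel" for i by measurable
      have "(\<Union>i. A i) \<in> sets lborel" by measurable
      then show "set_integrable lborel (\<Union>i. A i) f" by (rule int)
    qed (use union(1) in \<open>auto simp: disjoint_family_on_def\<close>)
    then show ?case using union by simp
  qed
qed

text \<open>
  Products of two box bumps are test functions on \<open>\<Omega>\<close> as soon as one of the closed boxes lies in \<open>\<Omega>\<close>,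
  and converge boundedly to the indicator of the intersection of the boxes.
\<close>
lemma AE_zero_on_box_if_test_integrals_zero:
  assumes \<Omega>: "open \<Omega>" and g: "g \<in> L1_loc \<Omega>" and ab: "cbox a b \<subseteq> \<Omega>"
    and zero: "\<And>\<phi>. \<phi> \<in> test_functions \<Omega> \<Longrightarrow> (\<integral>x. g x * \<phi> x \<partial>lebesgue_on \<Omega>) = 0"
  shows "AE x in lebesgue. x \<in> box a b \<longrightarrow> g x = 0"
proof -
  have K: "cbox a b \<inter> space lebesgue \<in> sets lebesgue" by simp
  have int_K: "integrable lebesgue (\<lambda>x. indicator (cbox a b) x *\<^sub>R g x)"
    using g ab compact_cbox unfolding L1_loc_def integrable_restrict_space[OF K, symmetric] by blast
  define f where "f x = indicator (box a b) x * g x" for x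
  have f_alt: "f = (\<lambda>x. indicator (box a b) x *\<^sub>R (indicator (cbox a b) x *\<^sub>R g x))"
    using box_subset_cbox[of a b] by (auto simp: f_def indicator_def fun_eq_iff)
  have int_f: "integrable lebesgue f"
    unfolding f_alt by (rule integrable_mult_indicator[OF _ int_K]) simp
  have zero': "(\<integral>x. indicator (box c d) x * f x \<partial>lebesgue) = 0" for c d
  proof -
    let ?s = "\<lambda>n x. g x * (box_bump a b n x * box_bump c d n x)"
    have "(\<lambda>n. \<integral>x. ?s n x \<partial>lebesgue) \<longlonglongrightarrow> (\<integral>x. indicator (box c d) x * f x \<partial>lebesgue)"
    proof (rule integral_dominated_convergence[where w = "\<lambda>x. norm (indicator (cbox a b) x *\<^sub>R g x)"])
      have s_alt: "?s n x = (indicator (cbox a b) x *\<^sub>R g x) * (box_bump a b n x * box_bump c d n x)" for n x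
        using box_subset_cbox[of a b] box_bump_nonzero_iff[of a b n x] by (auto simp: indicator_def)
      have [measurable]: "box_bump u v n \<in> borel_measurable lebesgue" for u v n
        using borel_measurable_continuous_onI[OF C_k_continuous[OF box_bump_C_k]]
        by (simp add: measurable_completion)
      have [measurable]: "(\<lambda>x. indicator (cbox a b) x *\<^sub>R g x) \<in> borel_measurable lebesgue"
        using int_K by simp
      show "?s n \<in> borel_measurable lebesgue" for n
        unfolding s_alt by measurable
      show "(\<lambda>x. indicator (box c d) x * f x) \<in> borel_measurable lebesgue"
        using int_f by (intro borel_measurable_times borel_measurable_indicator) auto
      show "AE x in lebesgue. (\<lambda>n. ?s n x) \<longlonglongrightarrow> indicator (box c d) x * f x"
      proof (intro AE_I2)
        fix x
        have "(\<lambda>n. ?s n x) \<longlonglongrightarrow> g x * (indicator (box a b) x * indicator (box c d) x)"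
          by (intro tendsto_intros box_bump_tendsto)
        then show "(\<lambda>n. ?s n x) \<longlonglongrightarrow> indicator (box c d) x * f x"
          by (simp add: f_def mult_ac)
      qed
      show "AE x in lebesgue. norm (?s n x) \<le> norm (indicator (cbox a b) x *\<^sub>R g x)" for n
      proof (intro AE_I2)
        fix x
        have "\<bar>box_bump a b n x * box_bump c d n x\<bar> \<le> 1"
          using box_bump_bounds by (simp add: abs_mult mult_le_one)
        then have "norm (indicator (cbox a b) x *\<^sub>R g x) * \<bar>box_bump a b n x * box_bump c d n x\<bar>
            \<le> norm (indicator (cbox a b) x *\<^sub>R g x) * 1"
          by (intro mult_left_mono) auto
        then show "norm (?s n x) \<le> norm (indicator (cbox a b) x *\<^sub>R g x)"
          unfolding s_alt by (simp add: abs_mult)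
      qed
      show "integrable lebesgue (\<lambda>x. norm (indicator (cbox a b) x *\<^sub>R g x))"
        using int_K by (rule integrable_norm)
    qed
    moreover have "(\<integral>x. ?s n x \<partial>lebesgue) = 0" for n
    proof -
      have "(\<lambda>x. box_bump a b n x * box_bump c d n x) \<in> test_functions \<Omega>"
        by (rule test_functions_mult[OF box_bump_test[OF ab] box_bump_C_k])
      from zero[OF this] integrable_L1_loc_mult_test_function(2)[OF g this \<Omega>] show ?thesis
        by simp
    qed
    ultimately have "(\<lambda>_. 0 :: real) \<longlonglongrightarrow> (\<integral>x. indicator (box c d) x * f x \<partial>lebesgue)"
      by simp
    then show ?thesis by (simp add: LIMSEQ_const_iff)
  qed
  \<comment> \<open>The generating property of boxes concerns Borel sets, hence the passage to a Borel
    representative of \<open>f\<close>.\<close>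
  obtain f' where f' [measurable]: "f' \<in> borel_measurable lborel" and ae: "AE x in lborel. f x = f' x"
    using completion_ex_borel_measurable_real[of f lborel] int_f by auto
  have ae': "AE x in lebesgue. f x = f' x" using ae by (rule AE_completion)
  have f'_leb: "f' \<in> borel_measurable lebesgue" using f' by (rule measurable_completion)
  have "integrable lebesgue f'"
    using int_f integrable_cong_AE[OF borel_measurable_integrable[OF int_f] f'_leb ae'] by blast
  then have int_f': "integrable lborel f'" by (simp add: integrable_completion)
  have box': "(\<integral>x. indicator (box c d) x * f' x \<partial>lborel) = 0" for c d
  proof -
    have "(\<integral>x. indicator (box c d) x * f' x \<partial>lborel) = (\<integral>x. indicator (box c d) x * f' x \<partial>lebesgue)"
      by (subst integral_completion) auto
    also have "\<dots> = (\<integral>x. indicator (box c d) x * f x \<partial>lebesgue)"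
      using int_f f'_leb ae'
      by (intro integral_cong_AE borel_measurable_times borel_measurable_indicator) auto
    finally show ?thesis using zero' by simp
  qed
  \<comment> \<open>The integral over the whole plane is one over a box as well, because \<open>f\<close> vanishes outside
    \<open>box a b\<close>.\<close>
  have "(\<integral>x. f' x \<partial>lborel) = (\<integral>x. indicator (box a b) x * f' x \<partial>lborel)"
    using ae by (intro integral_cong_AE) (auto simp: f_def indicator_def)
  then have "AE x in lborel. f' x = 0"
    using AE_zero_if_box_integrals_zero[OF int_f' box'] box' by simp
  then have "AE x in lebesgue. f' x = 0" by (rule AE_completion)
  with ae' show ?thesis by eventually_elim (auto simp: f_def indicator_def)
qed

text \<open>
  An open set is a countable union of closed boxes, and the boundary of a box is a null set, so the
  claim is local.
\<close>
lemma fundamental_lemma_calculus_of_variations: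
  assumes \<Omega>: "open \<Omega>" and g: "g \<in> L1_loc \<Omega>"
    and zero: "\<And>\<phi>. \<phi> \<in> test_functions \<Omega> \<Longrightarrow> (\<integral>x. g x * \<phi> x \<partial>lebesgue_on \<Omega>) = 0"
  shows "AE x in lebesgue_on \<Omega>. g x = 0"
proof -
  obtain \<D> where \<D>: "countable \<D>" "\<D> \<subseteq> Pow \<Omega>" "\<And>X. X \<in> \<D> \<Longrightarrow> \<exists>a b. X = cbox a b" "\<Union>\<D> = \<Omega>"
    using open_countable_Union_open_cbox[OF \<Omega>] by blast
  have "AE x in lebesgue. x \<in> X \<longrightarrow> g x = 0" if X: "X \<in> \<D>" for X
  proof -
    obtain a b where X_eq: "X = cbox a b" using \<D>(3)[OF X] by blast
    then have "cbox a b \<subseteq> \<Omega>" using X \<D>(2) by blast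
    then have "AE x in lebesgue. x \<in> box a b \<longrightarrow> g x = 0"
      by (intro AE_zero_on_box_if_test_integrals_zero[OF \<Omega> g _ zero])
    moreover have "AE x in lebesgue. x \<notin> cbox a b - box a b"
      using negligible_frontier_interval negligible_iff_null_sets AE_not_in by blast
    ultimately show ?thesis unfolding X_eq by eventually_elim auto
  qed
  then have "AE x in lebesgue. \<forall>X\<in>\<D>. x \<in> X \<longrightarrow> g x = 0"
    using \<D>(1) by (intro AE_ball_countable')
  then have "AE x in lebesgue. x \<in> \<Omega> \<longrightarrow> g x = 0"
    using \<D>(4) by (auto elim!: eventually_mono)
  then show ?thesis using \<Omega> by (subst AE_restrict_space_iff) auto
qed

lemma L1_loc_add: "f \<in> L1_loc \<Omega> \<Longrightarrow> g \<in> L1_loc \<Omega> \<Longrightarrow> (\<lambda>x. f x + g x) \<in> L1_loc \<Omega>"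
  by (auto simp: L1_loc_def)

lemma L1_loc_scale: "f \<in> L1_loc \<Omega> \<Longrightarrow> (\<lambda>x. r * f x) \<in> L1_loc \<Omega>"
  by (auto simp: L1_loc_def)

lemma has_weak_pderiv_add:
  assumes \<Omega>: "open \<Omega>" and f: "has_weak_pderiv \<Omega> j f f'" and g: "has_weak_pderiv \<Omega> j g g'"
  shows "has_weak_pderiv \<Omega> j (\<lambda>x. f x + g x) (\<lambda>x. f' x + g' x)"
  unfolding has_weak_pderiv_def
proof (intro conjI ballI)
  fix \<phi> assume \<phi>: "\<phi> \<in> test_functions \<Omega>"
  note * = integrable_L1_loc_mult_test_function(1)[OF _ _ \<Omega>]
  show "(\<integral>x. (f x + g x) * pderiv_at j \<phi> x \<partial>lebesgue_on \<Omega>) =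
      - (\<integral>x. (f' x + g' x) * \<phi> x \<partial>lebesgue_on \<Omega>)"
    using f g \<phi> test_functions_pderiv[OF \<phi>, of j] *
    by (simp add: has_weak_pderiv_def distrib_right)
qed (use f g in \<open>auto simp: has_weak_pderiv_def intro: L1_loc_add\<close>)

lemma has_weak_pderiv_scale:
  assumes f: "has_weak_pderiv \<Omega> j f f'"
  shows "has_weak_pderiv \<Omega> j (\<lambda>x. r * f x) (\<lambda>x. r * f' x)"
  using f by (auto simp: has_weak_pderiv_def mult.assoc intro: L1_loc_scale)

lemma has_weak_pderiv_unique:
  assumes \<Omega>: "open \<Omega>" and g: "has_weak_pderiv \<Omega> j f g" and h: "has_weak_pderiv \<Omega> j f h"
  shows "AE x in lebesgue_on \<Omega>. g x = h x"
proof -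
  have "has_weak_pderiv \<Omega> j (\<lambda>x. f x + (- 1) * f x) (\<lambda>x. g x + (- 1) * h x)"
    by (intro has_weak_pderiv_add[OF \<Omega>] has_weak_pderiv_scale g h)
  then have "AE x in lebesgue_on \<Omega>. g x + (- 1) * h x = 0"
    by (intro fundamental_lemma_calculus_of_variations[OF \<Omega>]) (auto simp: has_weak_pderiv_def)
  then show ?thesis by (auto elim!: eventually_mono)
qed

lemma has_weak_pderiv_weak_pderiv:
  "has_weak_pderiv \<Omega> j f g \<Longrightarrow> has_weak_pderiv \<Omega> j f (weak_pderiv \<Omega> j f)"
  unfolding weak_pderiv_def using someI[of "has_weak_pderiv \<Omega> j f" g] by simp

lemma weak_pderiv_AE_eq:
  "open \<Omega> \<Longrightarrow> has_weak_pderiv \<Omega> j f g \<Longrightarrow> AE x in lebesgue_on \<Omega>. weak_pderiv \<Omega> j f x = g x"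
  using has_weak_pderiv_unique has_weak_pderiv_weak_pderiv by blast

lemma continuous_imp_L1_loc:
  assumes "continuous_on UNIV f" shows "f \<in> L1_loc \<Omega>"
  unfolding L1_loc_def
proof clarify
  fix K :: "plane set" assume K: "compact K"
  then have Ks: "K \<inter> space lebesgue \<in> sets lebesgue" by (simp add: lmeasurable_compact fmeasurableD)
  have "integrable lborel (\<lambda>x. indicator K x *\<^sub>R f x)"
    using assms K by (intro borel_integrable_compact) (auto intro: continuous_on_subset)
  then have "integrable lebesgue (\<lambda>x. indicator K x *\<^sub>R f x)"
    using integrable_completion[OF borel_measurable_integrable] by blast
  then show "integrable (lebesgue_on K) f"
    unfolding integrable_restrict_space[OF Ks] .
qed

text \<open>
  Integration by parts: the integral of the partial derivative of the product \<open>\<phi> * \<psi>\<close> vanishes.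
\<close>
lemma has_weak_pderiv_test_function:
  assumes \<Omega>: "open \<Omega>" and \<phi>: "\<phi> \<in> test_functions \<Omega>"
  shows "has_weak_pderiv \<Omega> j \<phi> (pderiv_at j \<phi>)"
  unfolding has_weak_pderiv_def
proof (intro conjI ballI)
  fix \<psi> assume \<psi>: "\<psi> \<in> test_functions \<Omega>"
  let ?d = "\<lambda>x. \<phi> x * pderiv_at j \<psi> x" and ?e = "\<lambda>x. pderiv_at j \<phi> x * \<psi> x"
  have d: "?d \<in> test_functions \<Omega>" and e: "?e \<in> test_functions \<Omega>" and p: "(\<lambda>x. \<phi> x * \<psi> x) \<in> test_functions \<Omega>"
    using \<phi> \<psi> test_functions_pderiv test_functions_mult test_functions_C_k by metis+
  have "(\<integral>x. ?d x + ?e x \<partial>lborel) = 0"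
    using integral_pderiv_test_function[OF p, of j] pderiv_at_mult[OF test_functions_differentiable[OF \<phi>] test_functions_differentiable[OF \<psi>]]
    by simp
  then have "(\<integral>x. ?d x \<partial>lborel) = - (\<integral>x. ?e x \<partial>lborel)"
    using test_function_integrable[OF d] test_function_integrable[OF e] by simp
  moreover have "(\<integral>x. \<theta> x \<partial>lebesgue_on \<Omega>) = (\<integral>x. \<theta> x \<partial>lborel)" if "\<theta> \<in> test_functions \<Omega>" for \<theta>
  proof (rule integral_lebesgue_on_borel[OF \<Omega> test_functions_measurable[OF that]])
    show "\<theta> x = 0" if "x \<notin> \<Omega>" for x
      using test_functions_zero_outside \<open>\<theta> \<in> test_functions \<Omega>\<close> that by blast
  qed
  ultimately show "(\<integral>x. ?d x \<partial>lebesgue_on \<Omega>) = - (\<integral>x. ?e x \<partial>lebesgue_on \<Omega>)"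
    using d e by simp
qed (use \<phi> test_functions_pderiv[OF \<phi>, of j] in \<open>blast intro: continuous_imp_L1_loc test_functions_continuous\<close>)+

section \<open>The seminormed spaces\<close>

text \<open>
  Functions are not identified when they agree almost everywhere, so the Sobolev and \<open>L\<^sup>2\<close> norms
  are only seminorms. The velocities and the pressures both live in such a space, and
  square-integrable random elements are treated for both at once.
\<close>
locale function_seminorm =
  fixes X :: "('a \<Rightarrow> 'b::real_vector) set" and N :: "('a \<Rightarrow> 'b) \<Rightarrow> real"
  assumes add_closed: "u \<in> X \<Longrightarrow> v \<in> X \<Longrightarrow> (\<lambda>x. u x + v x) \<in> X"
    and scale_closed: "u \<in> X \<Longrightarrow> (\<lambda>x. r *\<^sub>R u x) \<in> X"
    and triangle: "u \<in> X \<Longrightarrow> v \<in> X \<Longrightarrow> N (\<lambda>x. u x + v x) \<le> N u + N v"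
    and scale: "u \<in> X \<Longrightarrow> N (\<lambda>x. r *\<^sub>R u x) = \<bar>r\<bar> * N u"
begin

lemma diff_closed: "u \<in> X \<Longrightarrow> v \<in> X \<Longrightarrow> (\<lambda>x. u x - v x) \<in> X"
  using add_closed[OF _ scale_closed[of v "- 1"], of u] by simp

lemma nonneg: assumes u: "u \<in> X" shows "0 \<le> N u"
proof -
  have "0 = N (\<lambda>x. 0 *\<^sub>R u x)" using scale[OF u, of 0] by simp
  also have "\<dots> = N (\<lambda>x. u x + (- 1) *\<^sub>R u x)" by simp
  also have "\<dots> \<le> N u + N u"
    using triangle[OF u scale_closed[OF u, of "- 1"]] scale[OF u, of "- 1"] by simp
  finally show ?thesis by simp
qed

lemma diff_commute: assumes "u \<in> X" "v \<in> X" shows "N (\<lambda>x. u x - v x) = N (\<lambda>x. v x - u x)"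
  using scale[OF diff_closed[OF assms], of "- 1"] by simp

lemma abs_diff_le: assumes "u \<in> X" "v \<in> X" shows "\<bar>N u - N v\<bar> \<le> N (\<lambda>x. u x - v x)"
proof -
  have "N u \<le> N (\<lambda>x. u x - v x) + N v" if "u \<in> X" "v \<in> X" for u v
    using triangle[OF diff_closed[OF that] that(2)] by simp
  from this[OF assms] this[OF assms(2,1)] diff_commute[OF assms] show ?thesis by simp
qed

end

lemma L2_measurable: "f \<in> L2 \<Omega> \<Longrightarrow> f \<in> borel_measurable (lebesgue_on \<Omega>)"
  by (simp add: L2_def)

lemma L2_mult_integrable:
  assumes "f \<in> L2 \<Omega>" "g \<in> L2 \<Omega>"
  shows "integrable (lebesgue_on \<Omega>) (\<lambda>x. f x * g x)"
proof (rule Bochner_Integration.integrable_bound)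
  show "integrable (lebesgue_on \<Omega>) (\<lambda>x. (f x)\<^sup>2 + (g x)\<^sup>2)"
    using assms by (simp add: L2_def)
  show "AE x in lebesgue_on \<Omega>. norm (f x * g x) \<le> norm ((f x)\<^sup>2 + (g x)\<^sup>2)"
  proof (intro AE_I2)
    fix x
    have "2 * (\<bar>f x\<bar> * \<bar>g x\<bar>) \<le> (f x)\<^sup>2 + (g x)\<^sup>2"
      using sum_squares_bound[of "\<bar>f x\<bar>" "\<bar>g x\<bar>"] by simp
    moreover have "0 \<le> \<bar>f x\<bar> * \<bar>g x\<bar>" by simp
    ultimately have "\<bar>f x\<bar> * \<bar>g x\<bar> \<le> (f x)\<^sup>2 + (g x)\<^sup>2" by linarith
    then show "norm (f x * g x) \<le> norm ((f x)\<^sup>2 + (g x)\<^sup>2)"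
      by (simp add: abs_mult)
  qed
qed (use assms in \<open>auto simp: L2_def\<close>)

lemma L2_norm_sq: "(L2_norm \<Omega> f)\<^sup>2 = (\<integral>x. (f x)\<^sup>2 \<partial>lebesgue_on \<Omega>)"
  by (simp add: L2_norm_def)

lemma L2_norm_nonneg [simp]: "0 \<le> L2_norm \<Omega> f"
  by (simp add: L2_norm_def)

lemma L2_Cauchy_Schwarz:
  assumes f: "f \<in> L2 \<Omega>" and g: "g \<in> L2 \<Omega>"
  shows "(\<integral>x. f x * g x \<partial>lebesgue_on \<Omega>) \<le> L2_norm \<Omega> f * L2_norm \<Omega> g"
proof -
  let ?M = "lebesgue_on \<Omega>"
  have [measurable]: "f \<in> borel_measurable ?M" "g \<in> borel_measurable ?M"
    using f g by (simp_all add: L2_measurable)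
  have sq: "(\<integral>\<^sup>+x. (ennreal \<bar>h x\<bar>)\<^sup>2 \<partial>?M) = ennreal ((L2_norm \<Omega> h)\<^sup>2)" if "h \<in> L2 \<Omega>" for h
    using that by (simp add: L2_norm_sq L2_def ennreal_power nn_integral_eq_integral)
  have "(\<integral>\<^sup>+x. ennreal \<bar>f x\<bar> * ennreal \<bar>g x\<bar> \<partial>?M) = (\<integral>\<^sup>+x. ennreal \<bar>f x * g x\<bar> \<partial>?M)"
    by (simp add: ennreal_mult abs_mult)
  also have "\<dots> = ennreal (\<integral>x. \<bar>f x * g x\<bar> \<partial>?M)"
    using L2_mult_integrable[OF f g] by (intro nn_integral_eq_integral) auto
  finally have "(ennreal (\<integral>x. \<bar>f x * g x\<bar> \<partial>?M))\<^sup>2 \<le> ennreal ((L2_norm \<Omega> f)\<^sup>2) * ennreal ((L2_norm \<Omega> g)\<^sup>2)"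
    using Cauchy_Schwarz_nn_integral[of "\<lambda>x. ennreal \<bar>f x\<bar>" ?M "\<lambda>x. ennreal \<bar>g x\<bar>"] sq[OF f] sq[OF g]
    by simp
  then have "(\<integral>x. \<bar>f x * g x\<bar> \<partial>?M)\<^sup>2 \<le> (L2_norm \<Omega> f * L2_norm \<Omega> g)\<^sup>2"
    by (simp add: ennreal_power ennreal_mult[symmetric] power_mult_distrib)
  then have "(\<integral>x. \<bar>f x * g x\<bar> \<partial>?M) \<le> L2_norm \<Omega> f * L2_norm \<Omega> g"
    by (rule power2_le_imp_le) simp
  moreover have "(\<integral>x. f x * g x \<partial>?M) \<le> (\<integral>x. \<bar>f x * g x\<bar> \<partial>?M)"
    using L2_mult_integrable[OF f g] by (intro integral_mono) auto
  ultimately show ?thesis by simp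
qed

lemma L2_add:
  assumes "f \<in> L2 \<Omega>" "g \<in> L2 \<Omega>" shows "(\<lambda>x. f x + g x) \<in> L2 \<Omega>"
  using assms L2_mult_integrable[OF assms]
  by (auto simp: L2_def power2_sum mult.assoc)

lemma L2_scale: "f \<in> L2 \<Omega> \<Longrightarrow> (\<lambda>x. r * f x) \<in> L2 \<Omega>"
  by (auto simp: L2_def power_mult_distrib)

lemma L2_norm_scale: "L2_norm \<Omega> (\<lambda>x. r * f x) = \<bar>r\<bar> * L2_norm \<Omega> f"
  by (simp add: L2_norm_def power_mult_distrib real_sqrt_mult)

lemma L2_norm_triangle:
  assumes f: "f \<in> L2 \<Omega>" and g: "g \<in> L2 \<Omega>"
  shows "L2_norm \<Omega> (\<lambda>x. f x + g x) \<le> L2_norm \<Omega> f + L2_norm \<Omega> g"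
proof (rule power2_le_imp_le)
  have "(L2_norm \<Omega> (\<lambda>x. f x + g x))\<^sup>2 =
      (\<integral>x. (f x)\<^sup>2 + (g x)\<^sup>2 + 2 * (f x * g x) \<partial>lebesgue_on \<Omega>)"
    by (simp add: L2_norm_sq power2_sum mult.assoc)
  also have "\<dots> = (L2_norm \<Omega> f)\<^sup>2 + (L2_norm \<Omega> g)\<^sup>2 + 2 * (\<integral>x. f x * g x \<partial>lebesgue_on \<Omega>)"
    using f g L2_mult_integrable[OF f g] by (simp add: L2_norm_sq L2_def)
  also have "\<dots> \<le> (L2_norm \<Omega> f + L2_norm \<Omega> g)\<^sup>2"
    using L2_Cauchy_Schwarz[OF f g] by (simp add: power2_sum)
  finally show "(L2_norm \<Omega> (\<lambda>x. f x + g x))\<^sup>2 \<le> (L2_norm \<Omega> f + L2_norm \<Omega> g)\<^sup>2" .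
qed simp

lemma L2_cong_AE:
  assumes "\<Omega> \<in> sets lebesgue" and f: "f \<in> L2 \<Omega>" and ae: "AE x in lebesgue_on \<Omega>. f x = g x"
  shows "g \<in> L2 \<Omega>" "L2_norm \<Omega> g = L2_norm \<Omega> f"
proof -
  have [measurable]: "f \<in> borel_measurable (lebesgue_on \<Omega>)" using f by (rule L2_measurable)
  have g [measurable]: "g \<in> borel_measurable (lebesgue_on \<Omega>)"
    using measurable_lebesgue_on_AE_eq[OF assms(1) _ ae] by simp
  have ae': "AE x in lebesgue_on \<Omega>. (f x)\<^sup>2 = (g x)\<^sup>2" using ae by eventually_elim simp
  have "integrable (lebesgue_on \<Omega>) (\<lambda>x. (f x)\<^sup>2) = integrable (lebesgue_on \<Omega>) (\<lambda>x. (g x)\<^sup>2)"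
    by (rule integrable_cong_AE[OF _ _ ae']) measurable
  then show "g \<in> L2 \<Omega>" using f g by (simp add: L2_def)
  have "(\<integral>x. (f x)\<^sup>2 \<partial>lebesgue_on \<Omega>) = (\<integral>x. (g x)\<^sup>2 \<partial>lebesgue_on \<Omega>)"
    by (rule integral_cong_AE[OF _ _ ae']) measurable
  then show "L2_norm \<Omega> g = L2_norm \<Omega> f" by (simp add: L2_norm_def)
qed

text \<open>
  On a bounded domain \<open>L\<^sup>2\<close> functions are integrable; otherwise the mean of a sum need not be the
  sum of the means.
\<close>
lemma function_seminorm_L2_0:
  assumes "bounded \<Omega>" "open \<Omega>" shows "function_seminorm (L2_0 \<Omega>) (L2_norm \<Omega>)"
proof -
  have 1: "(\<lambda>x. 1) \<in> L2 \<Omega>"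
    using assms by (simp add: L2_def lmeasurable_open integrable_on_const finite_measure.integrable_const finite_measure_lebesgue_on)
  have int: "integrable (lebesgue_on \<Omega>) f" if "f \<in> L2 \<Omega>" for f
    using L2_mult_integrable[OF that 1] by simp
  show ?thesis
  proof
    show "(\<lambda>x. u x + v x) \<in> L2_0 \<Omega>" if "u \<in> L2_0 \<Omega>" "v \<in> L2_0 \<Omega>" for u v
      using that int by (auto simp: L2_0_def intro: L2_add)
  qed (auto simp: L2_0_def L2_scale L2_norm_scale L2_norm_triangle)
qed

lemma weak_pderiv_H1:
  assumes "f \<in> H1 \<Omega>" shows "has_weak_pderiv \<Omega> j f (weak_pderiv \<Omega> j f)"
proof -
  obtain g where "has_weak_pderiv \<Omega> j f g" using assms by (auto simp: H1_def)
  then show ?thesis by (rule has_weak_pderiv_weak_pderiv)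
qed

lemma H1_L2: "f \<in> H1 \<Omega> \<Longrightarrow> f \<in> L2 \<Omega>"
  by (simp add: H1_def)

lemma H1I: "f \<in> L2 \<Omega> \<Longrightarrow> (\<And>j. g j \<in> L2 \<Omega>) \<Longrightarrow> (\<And>j. has_weak_pderiv \<Omega> j f (g j)) \<Longrightarrow> f \<in> H1 \<Omega>"
  by (auto simp: H1_def)

lemma weak_pderiv_L2:
  assumes "open \<Omega>" "f \<in> H1 \<Omega>" shows "weak_pderiv \<Omega> j f \<in> L2 \<Omega>"
proof -
  obtain g where g: "g \<in> L2 \<Omega>" "has_weak_pderiv \<Omega> j f g"
    using assms(2) by (auto simp: H1_def)
  have "AE x in lebesgue_on \<Omega>. g x = weak_pderiv \<Omega> j f x"
    using weak_pderiv_AE_eq[OF assms(1) g(2)] by eventually_elim simp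
  then show ?thesis
    using assms(1) by (intro L2_cong_AE(1)[OF _ g(1)]) auto
qed

lemma H1_add:
  assumes \<Omega>: "open \<Omega>" and f: "f \<in> H1 \<Omega>" and g: "g \<in> H1 \<Omega>"
  shows "(\<lambda>x. f x + g x) \<in> H1 \<Omega>"
  by (rule H1I[OF L2_add[OF H1_L2[OF f] H1_L2[OF g]]
        L2_add[OF weak_pderiv_L2[OF \<Omega> f] weak_pderiv_L2[OF \<Omega> g]]
        has_weak_pderiv_add[OF \<Omega> weak_pderiv_H1[OF f] weak_pderiv_H1[OF g]]])

lemma H1_scale:
  assumes \<Omega>: "open \<Omega>" and f: "f \<in> H1 \<Omega>"
  shows "(\<lambda>x. r * f x) \<in> H1 \<Omega>"
  by (rule H1I[OF L2_scale[OF H1_L2[OF f]] L2_scale[OF weak_pderiv_L2[OF \<Omega> f]]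
        has_weak_pderiv_scale[OF weak_pderiv_H1[OF f]]])

lemma weak_pderiv_add:
  assumes "open \<Omega>" "f \<in> H1 \<Omega>" "g \<in> H1 \<Omega>"
  shows "AE x in lebesgue_on \<Omega>.
    weak_pderiv \<Omega> j f x + weak_pderiv \<Omega> j g x = weak_pderiv \<Omega> j (\<lambda>x. f x + g x) x"
  using weak_pderiv_AE_eq[OF assms(1) has_weak_pderiv_add[OF assms(1) weak_pderiv_H1[OF assms(2)] weak_pderiv_H1[OF assms(3)]], of j]
  by eventually_elim simp

lemma weak_pderiv_scale:
  assumes "open \<Omega>" "f \<in> H1 \<Omega>"
  shows "AE x in lebesgue_on \<Omega>. r * weak_pderiv \<Omega> j f x = weak_pderiv \<Omega> j (\<lambda>x. r * f x) x"
  using weak_pderiv_AE_eq[OF assms(1) has_weak_pderiv_scale[OF weak_pderiv_H1[OF assms(2)]], of j r]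
  by eventually_elim simp

lemma H1_norm_alt:
  "H1_norm \<Omega> f = sqrt ((L2_norm \<Omega> f)\<^sup>2 + (L2_set (\<lambda>j. L2_norm \<Omega> (weak_pderiv \<Omega> j f)) UNIV)\<^sup>2)"
  by (simp add: H1_norm_def L2_set_def sum_nonneg)

lemma H1_norm_nonneg [simp]: "0 \<le> H1_norm \<Omega> f"
  by (simp add: H1_norm_alt)

lemma L2_norm_le_H1_norm: "L2_norm \<Omega> f \<le> H1_norm \<Omega> f"
  by (simp add: H1_norm_alt real_le_rsqrt)

text \<open>
  The norm is the Euclidean norm of the vector of \<open>L\<^sup>2\<close> norms of the function and its derivatives,
  so the inequality follows from the triangle inequalities for these two norms.
\<close>
lemma H1_norm_triangle:
  assumes \<Omega>: "open \<Omega>" and f: "f \<in> H1 \<Omega>" and g: "g \<in> H1 \<Omega>"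
  shows "H1_norm \<Omega> (\<lambda>x. f x + g x) \<le> H1_norm \<Omega> f + H1_norm \<Omega> g"
proof -
  have \<Omega>s: "\<Omega> \<in> sets lebesgue" using \<Omega> by auto
  define a where "a f = L2_norm \<Omega> f" for f
  define d where "d f j = L2_norm \<Omega> (weak_pderiv \<Omega> j f)" for f j
  have norm: "H1_norm \<Omega> f = sqrt ((a f)\<^sup>2 + (L2_set (d f) UNIV)\<^sup>2)" for f
    by (simp add: H1_norm_alt a_def d_def[abs_def])
  have "d (\<lambda>x. f x + g x) j \<le> d f j + d g j" for j
    unfolding d_def L2_cong_AE(2)[OF \<Omega>s L2_add[OF weak_pderiv_L2[OF \<Omega> f] weak_pderiv_L2[OF \<Omega> g]] weak_pderiv_add[OF \<Omega> f g, of j]]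
    by (intro L2_norm_triangle weak_pderiv_L2 \<Omega> f g)
  then have "L2_set (d (\<lambda>x. f x + g x)) UNIV \<le> L2_set (\<lambda>j. d f j + d g j) UNIV"
    by (intro L2_set_mono) (auto simp: d_def)
  also have "\<dots> \<le> L2_set (d f) UNIV + L2_set (d g) UNIV"
    by (rule L2_set_triangle_ineq)
  finally have d: "L2_set (d (\<lambda>x. f x + g x)) UNIV \<le> L2_set (d f) UNIV + L2_set (d g) UNIV" .
  have a: "a (\<lambda>x. f x + g x) \<le> a f + a g"
    unfolding a_def using f g by (intro L2_norm_triangle) (auto simp: H1_def)
  have "H1_norm \<Omega> (\<lambda>x. f x + g x) \<le> sqrt ((a f + a g)\<^sup>2 + (L2_set (d f) UNIV + L2_set (d g) UNIV)\<^sup>2)"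
    unfolding norm
    by (intro real_sqrt_le_mono add_mono power_mono a d) (auto simp: a_def)
  also have "\<dots> \<le> H1_norm \<Omega> f + H1_norm \<Omega> g"
    unfolding norm
    by (rule real_sqrt_sum_squares_triangle_ineq)
  finally show ?thesis .
qed

lemma H1_norm_scale:
  assumes \<Omega>: "open \<Omega>" and f: "f \<in> H1 \<Omega>"
  shows "H1_norm \<Omega> (\<lambda>x. r * f x) = \<bar>r\<bar> * H1_norm \<Omega> f"
proof -
  have \<Omega>s: "\<Omega> \<in> sets lebesgue" using \<Omega> by auto
  have "L2_norm \<Omega> (weak_pderiv \<Omega> j (\<lambda>x. r * f x)) = \<bar>r\<bar> * L2_norm \<Omega> (weak_pderiv \<Omega> j f)" for j
    unfolding L2_cong_AE(2)[OF \<Omega>s L2_scale[OF weak_pderiv_L2[OF \<Omega> f]] weak_pderiv_scale[OF \<Omega> f, of r j]]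
    by (rule L2_norm_scale)
  then have "H1_norm \<Omega> (\<lambda>x. r * f x) = sqrt (r\<^sup>2 * ((L2_norm \<Omega> f)\<^sup>2 + (\<Sum>j\<in>UNIV. (L2_norm \<Omega> (weak_pderiv \<Omega> j f))\<^sup>2)))"
    by (simp add: H1_norm_def L2_norm_scale power_mult_distrib distrib_left sum_distrib_left)
  then show ?thesis by (simp add: H1_norm_def real_sqrt_mult)
qed

lemma test_function_L2:
  assumes \<Omega>: "open \<Omega>" and \<phi>: "\<phi> \<in> test_functions \<Omega>" shows "\<phi> \<in> L2 \<Omega>"
proof -
  have "\<phi> \<in> borel_measurable (lebesgue_on \<Omega>)"
    using test_functions_measurable[OF \<phi>]
    by (intro measurable_restrict_space1) (simp add: measurable_completion)
  moreover have "integrable (lebesgue_on \<Omega>) (\<lambda>x. \<phi> x * \<phi> x)"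
    by (rule integrable_L1_loc_mult_test_function(1)[OF continuous_imp_L1_loc[OF test_functions_continuous[OF \<phi>]] \<phi> \<Omega>])
  ultimately show ?thesis by (simp add: L2_def power2_eq_square)
qed

lemma test_function_H1:
  assumes \<Omega>: "open \<Omega>" and \<phi>: "\<phi> \<in> test_functions \<Omega>" shows "\<phi> \<in> H1 \<Omega>"
  by (rule H1I[OF test_function_L2[OF \<Omega> \<phi>] test_function_L2[OF \<Omega> test_functions_pderiv[OF \<phi>]]
        has_weak_pderiv_test_function[OF assms]])

lemma function_seminorm_H1_0:
  assumes \<Omega>: "open \<Omega>" shows "function_seminorm (H1_0 \<Omega>) (H1_norm \<Omega>)"
proof
  fix f g assume f: "f \<in> H1_0 \<Omega>" and g: "g \<in> H1_0 \<Omega>"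
  have H1: "f \<in> H1 \<Omega>" "g \<in> H1 \<Omega>" using f g by (auto simp: H1_0_def)
  show "H1_norm \<Omega> (\<lambda>x. f x + g x) \<le> H1_norm \<Omega> f + H1_norm \<Omega> g"
    using H1 by (rule H1_norm_triangle[OF \<Omega>])
  have "\<exists>\<phi>\<in>test_functions \<Omega>. H1_norm \<Omega> (\<lambda>x. f x + g x - \<phi> x) < \<epsilon>" if \<epsilon>: "\<epsilon> > 0" for \<epsilon>
  proof -
    obtain \<phi> \<psi> where \<phi>: "\<phi> \<in> test_functions \<Omega>" "H1_norm \<Omega> (\<lambda>x. f x - \<phi> x) < \<epsilon> / 2"
      and \<psi>: "\<psi> \<in> test_functions \<Omega>" "H1_norm \<Omega> (\<lambda>x. g x - \<psi> x) < \<epsilon> / 2"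
      using f g half_gt_zero[OF \<epsilon>] unfolding H1_0_def by blast
    have diff: "(\<lambda>x. h x - \<theta> x) \<in> H1 \<Omega>" if "h \<in> H1 \<Omega>" "\<theta> \<in> test_functions \<Omega>" for h \<theta>
      using H1_add[OF \<Omega> that(1) H1_scale[OF \<Omega> test_function_H1[OF \<Omega> that(2)], of "- 1"]] by simp
    have "H1_norm \<Omega> (\<lambda>x. f x + g x - (\<phi> x + \<psi> x)) = H1_norm \<Omega> (\<lambda>x. (f x - \<phi> x) + (g x - \<psi> x))"
      by (simp add: algebra_simps)
    also have "\<dots> \<le> H1_norm \<Omega> (\<lambda>x. f x - \<phi> x) + H1_norm \<Omega> (\<lambda>x. g x - \<psi> x)"
      by (rule H1_norm_triangle[OF \<Omega> diff[OF H1(1) \<phi>(1)] diff[OF H1(2) \<psi>(1)]])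
    finally show ?thesis
      using \<phi>(2) \<psi>(2) test_functions_add[OF \<phi>(1) \<psi>(1)] by (intro bexI[of _ "\<lambda>x. \<phi> x + \<psi> x"]) auto
  qed
  then show "(\<lambda>x. f x + g x) \<in> H1_0 \<Omega>"
    using H1_add[OF \<Omega> H1] by (simp add: H1_0_def)
next
  fix f r assume f: "f \<in> H1_0 \<Omega>"
  then have H1: "f \<in> H1 \<Omega>" by (simp add: H1_0_def)
  show "H1_norm \<Omega> (\<lambda>x. r *\<^sub>R f x) = \<bar>r\<bar> * H1_norm \<Omega> f"
    using H1_norm_scale[OF \<Omega> H1] by simp
  have "\<exists>\<phi>\<in>test_functions \<Omega>. H1_norm \<Omega> (\<lambda>x. r * f x - \<phi> x) < \<epsilon>" if \<epsilon>: "\<epsilon> > 0" for \<epsilon>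
  proof -
    have "\<epsilon> / (\<bar>r\<bar> + 1) > 0" using \<epsilon> by simp
    then obtain \<phi> where \<phi>: "\<phi> \<in> test_functions \<Omega>" "H1_norm \<Omega> (\<lambda>x. f x - \<phi> x) < \<epsilon> / (\<bar>r\<bar> + 1)"
      using f unfolding H1_0_def by blast
    have diff: "(\<lambda>x. f x - \<phi> x) \<in> H1 \<Omega>"
      using H1_add[OF \<Omega> H1 H1_scale[OF \<Omega> test_function_H1[OF \<Omega> \<phi>(1)], of "- 1"]] by simp
    have "H1_norm \<Omega> (\<lambda>x. r * f x - r * \<phi> x) = \<bar>r\<bar> * H1_norm \<Omega> (\<lambda>x. f x - \<phi> x)"
      using H1_norm_scale[OF \<Omega> diff, of r] by (simp add: right_diff_distrib)
    also have "\<dots> \<le> (\<bar>r\<bar> + 1) * H1_norm \<Omega> (\<lambda>x. f x - \<phi> x)"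
      by (intro mult_right_mono) auto
    also have "\<dots> < \<epsilon>"
      using \<phi>(2) by (simp add: pos_less_divide_eq mult.commute)
    finally show ?thesis
      using test_functions_scale[OF \<phi>(1)] by (intro bexI[of _ "\<lambda>x. r * \<phi> x"])
  qed
  then show "(\<lambda>x. r *\<^sub>R f x) \<in> H1_0 \<Omega>"
    using H1_scale[OF \<Omega> H1] by (simp add: H1_0_def)
qed

lemma vH1_norm_alt: "vH1_norm \<Omega> u = L2_set (\<lambda>i. H1_norm \<Omega> (\<lambda>x. u x $ i)) UNIV"
  by (simp add: vH1_norm_def L2_set_def)

lemma function_seminorm_vH1_0:
  assumes \<Omega>: "open \<Omega>" shows "function_seminorm (vH1_0 \<Omega>) (vH1_norm \<Omega>)"
proof -
  interpret H1_0: function_seminorm "H1_0 \<Omega>" "H1_norm \<Omega>"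
    using \<Omega> by (rule function_seminorm_H1_0)
  show ?thesis
  proof
    fix u v assume u: "u \<in> vH1_0 \<Omega>" and v: "v \<in> vH1_0 \<Omega>"
    show "(\<lambda>x. u x + v x) \<in> vH1_0 \<Omega>"
      using u v H1_0.add_closed by (simp add: vH1_0_def)
    have "vH1_norm \<Omega> (\<lambda>x. u x + v x) \<le>
        L2_set (\<lambda>i. H1_norm \<Omega> (\<lambda>x. u x $ i) + H1_norm \<Omega> (\<lambda>x. v x $ i)) UNIV"
      unfolding vH1_norm_alt using u v by (intro L2_set_mono) (auto simp: vH1_0_def intro: H1_0.triangle)
    also have "\<dots> \<le> vH1_norm \<Omega> u + vH1_norm \<Omega> v"
      unfolding vH1_norm_alt by (rule L2_set_triangle_ineq)
    finally show "vH1_norm \<Omega> (\<lambda>x. u x + v x) \<le> vH1_norm \<Omega> u + vH1_norm \<Omega> v" .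
  next
    fix u r assume u: "u \<in> vH1_0 \<Omega>"
    show "(\<lambda>x. r *\<^sub>R u x) \<in> vH1_0 \<Omega>"
      using u H1_0.scale_closed by (simp add: vH1_0_def)
    have "H1_norm \<Omega> (\<lambda>x. (r *\<^sub>R u x) $ i) = \<bar>r\<bar> * H1_norm \<Omega> (\<lambda>x. u x $ i)" for i
      using u H1_0.scale[of "\<lambda>x. u x $ i" r] by (simp add: vH1_0_def)
    then show "vH1_norm \<Omega> (\<lambda>x. r *\<^sub>R u x) = \<bar>r\<bar> * vH1_norm \<Omega> u"
      unfolding vH1_norm_alt by (simp add: L2_set_right_distrib)
  qed
qed

section \<open>Multilinearity of the forms\<close>

text \<open>
  For a test function the weak derivatives agree almost everywhere with the classical ones, which
  turns the right-hand side of the Ladyzhenskaya inequality into a power of the Sobolev norm.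
\<close>
lemma nn_integral_test_function_power4:
  assumes \<Omega>: "open \<Omega>" and \<phi>: "\<phi> \<in> test_functions \<Omega>"
  shows "(\<integral>\<^sup>+x. ennreal ((\<phi> x) ^ 4) \<partial>lebesgue_on \<Omega>) \<le> ennreal ((H1_norm \<Omega> \<phi>) ^ 4)"
proof -
  note \<phi>j = test_functions_pderiv[OF \<phi>]
  have \<Omega>s: "\<Omega> \<in> sets lebesgue" using \<Omega> by auto
  have [measurable]: "\<phi> \<in> borel_measurable borel" "pderiv_at j \<phi> \<in> borel_measurable borel" for j
    using \<phi> \<phi>j test_functions_measurable by blast+
  have norm: "integrable lborel (\<lambda>x. (\<theta> x)\<^sup>2)" "(L2_norm \<Omega> \<theta>)\<^sup>2 = (\<integral>x. (\<theta> x)\<^sup>2 \<partial>lborel)"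
    if \<theta>: "\<theta> \<in> test_functions \<Omega>" for \<theta>
  proof -
    have m: "(\<lambda>x. (\<theta> x)\<^sup>2) \<in> borel_measurable borel"
      using test_functions_measurable[OF \<theta>] by simp
    have z: "\<And>x. x \<notin> \<Omega> \<Longrightarrow> (\<theta> x)\<^sup>2 = 0" using test_functions_zero_outside[OF \<theta>] by simp
    show "integrable lborel (\<lambda>x. (\<theta> x)\<^sup>2)"
      using test_function_L2[OF \<Omega> \<theta>] integrable_lebesgue_on_borel[OF \<Omega> m z] by (simp add: L2_def)
    show "(L2_norm \<Omega> \<theta>)\<^sup>2 = (\<integral>x. (\<theta> x)\<^sup>2 \<partial>lborel)"
      using integral_lebesgue_on_borel[OF \<Omega> m z] by (simp add: L2_norm_sq)
  qed
  have weak: "L2_norm \<Omega> (weak_pderiv \<Omega> j \<phi>) = L2_norm \<Omega> (pderiv_at j \<phi>)" for j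
  proof (rule L2_cong_AE(2)[OF \<Omega>s test_function_L2[OF \<Omega> \<phi>j]])
    show "AE x in lebesgue_on \<Omega>. pderiv_at j \<phi> x = weak_pderiv \<Omega> j \<phi> x"
      using weak_pderiv_AE_eq[OF \<Omega> has_weak_pderiv_test_function[OF \<Omega> \<phi>], of j] by eventually_elim simp
  qed
  have "(\<integral>\<^sup>+x. ennreal ((\<phi> x)\<^sup>2 + (\<Sum>j\<in>UNIV. (pderiv_at j \<phi> x)\<^sup>2)) \<partial>lborel) =
      ennreal (\<integral>x. (\<phi> x)\<^sup>2 + (\<Sum>j\<in>UNIV. (pderiv_at j \<phi> x)\<^sup>2) \<partial>lborel)"
    using norm(1) \<phi> \<phi>j by (intro nn_integral_eq_integral) (auto simp: sum_nonneg)
  also have "(\<integral>x. (\<phi> x)\<^sup>2 + (\<Sum>j\<in>UNIV. (pderiv_at j \<phi> x)\<^sup>2) \<partial>lborel) = (H1_norm \<Omega> \<phi>)\<^sup>2"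
    using norm \<phi> \<phi>j by (simp add: H1_norm_def weak sum_nonneg integral_sum)
  finally have "(\<integral>\<^sup>+x. ennreal ((\<phi> x)\<^sup>2 + (\<Sum>j\<in>UNIV. (pderiv_at j \<phi> x)\<^sup>2)) \<partial>lborel)\<^sup>2 =
      ennreal ((H1_norm \<Omega> \<phi>) ^ 4)"
    by (simp add: ennreal_power)
  moreover have "(\<integral>\<^sup>+x. ennreal ((\<phi> x) ^ 4) \<partial>lebesgue_on \<Omega>) = (\<integral>\<^sup>+x. ennreal ((\<phi> x) ^ 4) \<partial>lborel)"
    using test_functions_zero_outside[OF \<phi>] by (intro nn_integral_lebesgue_on_borel[OF \<Omega>]) auto
  ultimately show ?thesis using Ladyzhenskaya_test_function[OF \<phi>] by simp
qed

text \<open>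
  This is the embedding of \<open>H\<^sup>1\<^sub>0\<close> into \<open>L\<^sup>4\<close>, which makes the convective term integrable. Test
  functions approximating \<open>f\<close> have bounded Sobolev norms, hence bounded \<open>L\<^sup>4\<close> norms; along a
  subsequence they converge almost everywhere, and Fatou's lemma passes the bound to \<open>f\<close>.
\<close>
lemma H1_0_power4_integrable:
  assumes \<Omega>: "open \<Omega>" and f: "f \<in> H1_0 \<Omega>"
  shows "integrable (lebesgue_on \<Omega>) (\<lambda>x. (f x) ^ 4)"
proof -
  let ?M = "lebesgue_on \<Omega>"
  interpret H1_0: function_seminorm "H1_0 \<Omega>" "H1_norm \<Omega>"
    using \<Omega> by (rule function_seminorm_H1_0)
  have fH1: "f \<in> H1 \<Omega>" using f by (simp add: H1_0_def)
  have [measurable]: "f \<in> borel_measurable ?M" using fH1 by (simp add: H1_def L2_def)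
  have "\<exists>\<phi>\<in>test_functions \<Omega>. H1_norm \<Omega> (\<lambda>x. f x - \<phi> x) < inverse (real (Suc n))" for n
    using f unfolding H1_0_def by simp
  then obtain \<phi> where \<phi>: "\<And>n. \<phi> n \<in> test_functions \<Omega>"
    "\<And>n. H1_norm \<Omega> (\<lambda>x. f x - \<phi> n x) < inverse (real (Suc n))"
    by metis
  have [measurable]: "\<phi> n \<in> borel_measurable ?M" for n
    using test_function_L2[OF \<Omega> \<phi>(1)] by (rule L2_measurable)
  have diff: "(\<lambda>x. f x + (- 1) * \<phi> n x) \<in> H1 \<Omega>" for n
    by (intro H1_add H1_scale \<Omega> fH1 test_function_H1 \<phi>)
  then have diff_L2: "(\<lambda>x. f x - \<phi> n x) \<in> L2 \<Omega>" for n
    by (simp add: H1_def)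
  have bound: "H1_norm \<Omega> (\<phi> n) \<le> H1_norm \<Omega> f + 1" for n
  proof -
    have "H1_norm \<Omega> (\<phi> n) = H1_norm \<Omega> (\<lambda>x. f x + (- 1) * (f x + (- 1) * \<phi> n x))"
      by simp
    also have "\<dots> \<le> H1_norm \<Omega> f + H1_norm \<Omega> (\<lambda>x. (- 1) * (f x + (- 1) * \<phi> n x))"
      by (rule H1_norm_triangle[OF \<Omega> fH1 H1_scale[OF \<Omega> diff]])
    also have "H1_norm \<Omega> (\<lambda>x. (- 1) * (f x + (- 1) * \<phi> n x)) = H1_norm \<Omega> (\<lambda>x. f x - \<phi> n x)"
      unfolding H1_norm_scale[OF \<Omega> diff] by simp
    also have "\<dots> \<le> 1"
      using \<phi>(2)[of n] by (rule order_trans[OF less_imp_le]) (simp add: field_simps)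
    finally show ?thesis by simp
  qed
  have "\<exists>r::nat\<Rightarrow>nat. strict_mono r \<and> (AE x in ?M. (\<lambda>n. (f x - \<phi> (r n) x)\<^sup>2) \<longlonglongrightarrow> 0)"
  proof (rule tendsto_L1_AE_subseq)
    show "integrable ?M (\<lambda>x. (f x - \<phi> n x)\<^sup>2)" for n
      using diff_L2 by (simp add: L2_def)
    show "(\<lambda>n. \<integral>x. norm ((f x - \<phi> n x)\<^sup>2) \<partial>?M) \<longlonglongrightarrow> 0"
    proof (rule tendsto_sandwich[of "\<lambda>_. 0" _ _ "\<lambda>n. (inverse (real (Suc n)))\<^sup>2"])
      show "(\<lambda>n. (inverse (real (Suc n)))\<^sup>2) \<longlonglongrightarrow> 0"
        using tendsto_power[OF LIMSEQ_inverse_real_of_nat, of 2] by simp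
      show "\<forall>\<^sub>F n in sequentially. (\<integral>x. norm ((f x - \<phi> n x)\<^sup>2) \<partial>?M) \<le> (inverse (real (Suc n)))\<^sup>2"
      proof (intro always_eventually allI)
        fix n
        have "(L2_norm \<Omega> (\<lambda>x. f x - \<phi> n x))\<^sup>2 \<le> (inverse (real (Suc n)))\<^sup>2"
          using L2_norm_le_H1_norm[of \<Omega> "\<lambda>x. f x - \<phi> n x"] \<phi>(2)[of n] by (intro power_mono) auto
        then show "(\<integral>x. norm ((f x - \<phi> n x)\<^sup>2) \<partial>?M) \<le> (inverse (real (Suc n)))\<^sup>2"
          by (simp add: L2_norm_sq)
      qed
    qed auto
  qed
  then obtain r :: "nat \<Rightarrow> nat" where r: "AE x in ?M. (\<lambda>n. (f x - \<phi> (r n) x)\<^sup>2) \<longlonglongrightarrow> 0"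
    by blast
  have lim: "AE x in ?M. ennreal ((f x) ^ 4) = liminf (\<lambda>n. ennreal ((\<phi> (r n) x) ^ 4))"
    using r
  proof eventually_elim
    case (elim x)
    have "(\<lambda>n. sqrt ((f x - \<phi> (r n) x)\<^sup>2)) \<longlonglongrightarrow> sqrt 0"
      using elim by (rule tendsto_real_sqrt)
    then have "(\<lambda>n. f x - \<phi> (r n) x) \<longlonglongrightarrow> 0"
      by (simp add: tendsto_rabs_zero_iff)
    then have "(\<lambda>n. f x - (f x - \<phi> (r n) x)) \<longlonglongrightarrow> f x - 0"
      by (intro tendsto_intros)
    then have "(\<lambda>n. ennreal ((\<phi> (r n) x) ^ 4)) \<longlonglongrightarrow> ennreal ((f x) ^ 4)"
      by (intro tendsto_ennrealI tendsto_power) simp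
    then show ?case by (intro lim_imp_Liminf[symmetric]) auto
  qed
  have "(\<integral>\<^sup>+x. ennreal ((f x) ^ 4) \<partial>?M) = (\<integral>\<^sup>+x. liminf (\<lambda>n. ennreal ((\<phi> (r n) x) ^ 4)) \<partial>?M)"
    using lim by (rule nn_integral_cong_AE)
  also have "\<dots> \<le> liminf (\<lambda>n. \<integral>\<^sup>+x. ennreal ((\<phi> (r n) x) ^ 4) \<partial>?M)"
    by (rule nn_integral_liminf) simp
  also have "\<dots> \<le> liminf (\<lambda>n. ennreal ((H1_norm \<Omega> f + 1) ^ 4))"
  proof (intro Liminf_mono always_eventually allI)
    fix n
    have "(\<integral>\<^sup>+x. ennreal ((\<phi> (r n) x) ^ 4) \<partial>?M) \<le> ennreal ((H1_norm \<Omega> (\<phi> (r n))) ^ 4)"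
      by (rule nn_integral_test_function_power4[OF \<Omega> \<phi>(1)])
    also have "\<dots> \<le> ennreal ((H1_norm \<Omega> f + 1) ^ 4)"
      by (intro ennreal_leI power_mono bound) simp
    finally show "(\<integral>\<^sup>+x. ennreal ((\<phi> (r n) x) ^ 4) \<partial>?M) \<le> ennreal ((H1_norm \<Omega> f + 1) ^ 4)" .
  qed
  also have "\<dots> < \<infinity>" by (simp add: Liminf_const)
  finally show ?thesis
    by (intro integrableI_nonneg) auto
qed

lemma H1_0_mult_L2:
  assumes \<Omega>: "open \<Omega>" and f: "f \<in> H1_0 \<Omega>" and g: "g \<in> H1_0 \<Omega>"
  shows "(\<lambda>x. f x * g x) \<in> L2 \<Omega>"
proof -
  have [measurable]: "f \<in> borel_measurable (lebesgue_on \<Omega>)" "g \<in> borel_measurable (lebesgue_on \<Omega>)"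
    using f g by (simp_all add: H1_0_def H1_def L2_def)
  have "(\<lambda>x. (f x)\<^sup>2) \<in> L2 \<Omega>" "(\<lambda>x. (g x)\<^sup>2) \<in> L2 \<Omega>"
    using H1_0_power4_integrable[OF \<Omega>] f g by (simp_all add: L2_def)
  from L2_mult_integrable[OF this] show ?thesis
    by (simp add: L2_def power_mult_distrib)
qed

text \<open>
  The additivity of the forms in a differentiated argument all comes down to this lemma. In the
  convective term the factor \<open>h\<close> is a product of two components of velocities, whence the
  importance of having such products in \<open>L\<^sup>2\<close>.
\<close>
lemma integral_mult_weak_pderiv_add:
  assumes \<Omega>: "open \<Omega>" and h: "h \<in> L2 \<Omega>" and f: "f \<in> H1 \<Omega>" and g: "g \<in> H1 \<Omega>"
  shows "(\<integral>x. h x * weak_pderiv \<Omega> j (\<lambda>x. f x + g x) x \<partial>lebesgue_on \<Omega>) =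
    (\<integral>x. h x * weak_pderiv \<Omega> j f x \<partial>lebesgue_on \<Omega>) + (\<integral>x. h x * weak_pderiv \<Omega> j g x \<partial>lebesgue_on \<Omega>)"
proof -
  note L2 = weak_pderiv_L2[OF \<Omega> H1_add[OF \<Omega> f g]] weak_pderiv_L2[OF \<Omega> f] weak_pderiv_L2[OF \<Omega> g] h
  note [measurable] = L2[THEN L2_measurable]
  have "(\<integral>x. h x * weak_pderiv \<Omega> j (\<lambda>x. f x + g x) x \<partial>lebesgue_on \<Omega>) =
      (\<integral>x. h x * weak_pderiv \<Omega> j f x + h x * weak_pderiv \<Omega> j g x \<partial>lebesgue_on \<Omega>)"
  proof (rule integral_cong_AE)
    show "AE x in lebesgue_on \<Omega>. h x * weak_pderiv \<Omega> j (\<lambda>x. f x + g x) x =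
        h x * weak_pderiv \<Omega> j f x + h x * weak_pderiv \<Omega> j g x"
      using weak_pderiv_add[OF \<Omega> f g, of j] by eventually_elim (simp flip: distrib_left)
  qed measurable
  also have "\<dots> = (\<integral>x. h x * weak_pderiv \<Omega> j f x \<partial>lebesgue_on \<Omega>) + (\<integral>x. h x * weak_pderiv \<Omega> j g x \<partial>lebesgue_on \<Omega>)"
    using L2 by (intro Bochner_Integration.integral_add L2_mult_integrable)
  finally show ?thesis .
qed

lemma vH1_0_component: "u \<in> vH1_0 \<Omega> \<Longrightarrow> (\<lambda>x. u x $ i) \<in> H1_0 \<Omega>"
  by (simp add: vH1_0_def)

lemma vH1_0_component_H1: "u \<in> vH1_0 \<Omega> \<Longrightarrow> (\<lambda>x. u x $ i) \<in> H1 \<Omega>"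
  by (simp add: vH1_0_def H1_0_def)

lemma a_form_sum:
  assumes \<Omega>: "open \<Omega>" and "u \<in> vH1_0 \<Omega>" "v \<in> vH1_0 \<Omega>"
  shows "a_form \<Omega> \<nu> u v = \<nu> * (\<Sum>i\<in>UNIV. \<Sum>j\<in>UNIV. \<integral>x. D \<Omega> j i v x * D \<Omega> j i u x \<partial>lebesgue_on \<Omega>)"
  unfolding a_form_def using L2_mult_integrable weak_pderiv_L2[OF \<Omega> vH1_0_component_H1] assms(2,3)
  by (simp add: integral_sum mult.commute)

lemma b_form_sum:
  assumes \<Omega>: "open \<Omega>" and "u \<in> vH1_0 \<Omega>" "q \<in> L2 \<Omega>"
  shows "b_form \<Omega> u q = - (\<Sum>i\<in>UNIV. \<integral>x. q x * D \<Omega> i i u x \<partial>lebesgue_on \<Omega>)"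
  unfolding b_form_def using L2_mult_integrable weak_pderiv_L2[OF \<Omega> vH1_0_component_H1] assms(2,3)
  by (simp add: integral_sum sum_distrib_left)

lemma c_form_sum:
  assumes \<Omega>: "open \<Omega>" and "u \<in> vH1_0 \<Omega>" "w \<in> vH1_0 \<Omega>" "v \<in> vH1_0 \<Omega>"
  shows "c_form \<Omega> u w v =
    (\<Sum>i\<in>UNIV. \<Sum>j\<in>UNIV. \<integral>x. (u x $ j * v x $ i) * D \<Omega> j i w x \<partial>lebesgue_on \<Omega>)"
proof -
  have "integrable (lebesgue_on \<Omega>) (\<lambda>x. (u x $ j * v x $ i) * D \<Omega> j i w x)" for i j
    by (intro L2_mult_integrable H1_0_mult_L2 \<Omega> weak_pderiv_L2 vH1_0_component vH1_0_component_H1 assms)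
  then show ?thesis
    unfolding c_form_def by (simp add: integral_sum mult_ac)
qed

lemma a_form_add:
  assumes \<Omega>: "open \<Omega>" and u: "u \<in> vH1_0 \<Omega>" and w: "w \<in> vH1_0 \<Omega>" and v: "v \<in> vH1_0 \<Omega>"
  shows "a_form \<Omega> \<nu> (\<lambda>x. u x + w x) v = a_form \<Omega> \<nu> u v + a_form \<Omega> \<nu> w v"
proof -
  interpret function_seminorm "vH1_0 \<Omega>" "vH1_norm \<Omega>" using \<Omega> by (rule function_seminorm_vH1_0)
  show ?thesis
    using integral_mult_weak_pderiv_add[OF \<Omega> weak_pderiv_L2[OF \<Omega> vH1_0_component_H1[OF v]]
        vH1_0_component_H1[OF u] vH1_0_component_H1[OF w]]
    by (simp add: a_form_sum[OF \<Omega>] u w v add_closed sum.distrib distrib_left)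
qed

lemma b_form_add:
  assumes \<Omega>: "open \<Omega>" and u: "u \<in> vH1_0 \<Omega>" and w: "w \<in> vH1_0 \<Omega>" and q: "q \<in> L2 \<Omega>"
  shows "b_form \<Omega> (\<lambda>x. u x + w x) q = b_form \<Omega> u q + b_form \<Omega> w q"
proof -
  interpret function_seminorm "vH1_0 \<Omega>" "vH1_norm \<Omega>" using \<Omega> by (rule function_seminorm_vH1_0)
  show ?thesis
    using integral_mult_weak_pderiv_add[OF \<Omega> q vH1_0_component_H1[OF u] vH1_0_component_H1[OF w]]
    by (simp add: b_form_sum[OF \<Omega>] u w q add_closed sum.distrib)
qed

lemma b_form_pressure_add:
  assumes \<Omega>: "open \<Omega>" and u: "u \<in> vH1_0 \<Omega>" and p: "p \<in> L2 \<Omega>" and q: "q \<in> L2 \<Omega>"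
  shows "b_form \<Omega> u (\<lambda>x. p x + q x) = b_form \<Omega> u p + b_form \<Omega> u q"
  using L2_mult_integrable[OF p weak_pderiv_L2[OF \<Omega> vH1_0_component_H1[OF u]]]
    L2_mult_integrable[OF q weak_pderiv_L2[OF \<Omega> vH1_0_component_H1[OF u]]]
  by (simp add: b_form_sum[OF \<Omega> u] p q L2_add distrib_right sum.distrib)

lemma b_form_pressure_diff:
  assumes \<Omega>: "open \<Omega>" and u: "u \<in> vH1_0 \<Omega>" and p: "p \<in> L2 \<Omega>" and q: "q \<in> L2 \<Omega>"
  shows "b_form \<Omega> u (\<lambda>x. p x - q x) = b_form \<Omega> u p - b_form \<Omega> u q"
  using b_form_pressure_add[OF \<Omega> u L2_add[OF p L2_scale[OF q, of "- 1"]] q] by simp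

lemma c_form_add_convecting:
  assumes \<Omega>: "open \<Omega>" and u: "u \<in> vH1_0 \<Omega>" and z: "z \<in> vH1_0 \<Omega>" and w: "w \<in> vH1_0 \<Omega>" and v: "v \<in> vH1_0 \<Omega>"
  shows "c_form \<Omega> (\<lambda>x. u x + z x) w v = c_form \<Omega> u w v + c_form \<Omega> z w v"
proof -
  interpret function_seminorm "vH1_0 \<Omega>" "vH1_norm \<Omega>" using \<Omega> by (rule function_seminorm_vH1_0)
  have "integrable (lebesgue_on \<Omega>) (\<lambda>x. (y x $ j * v x $ i) * D \<Omega> j i w x)" if "y \<in> vH1_0 \<Omega>" for y i j
    by (intro L2_mult_integrable H1_0_mult_L2 \<Omega> weak_pderiv_L2 vH1_0_component vH1_0_component_H1 that v w)
  from this[OF u] this[OF z] show ?thesis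
    by (simp add: c_form_sum[OF \<Omega>] u z w v add_closed distrib_right sum.distrib)
qed

lemma c_form_add_convected:
  assumes \<Omega>: "open \<Omega>" and u: "u \<in> vH1_0 \<Omega>" and z: "z \<in> vH1_0 \<Omega>" and w: "w \<in> vH1_0 \<Omega>" and v: "v \<in> vH1_0 \<Omega>"
  shows "c_form \<Omega> u (\<lambda>x. w x + z x) v = c_form \<Omega> u w v + c_form \<Omega> u z v"
proof -
  interpret function_seminorm "vH1_0 \<Omega>" "vH1_norm \<Omega>" using \<Omega> by (rule function_seminorm_vH1_0)
  show ?thesis
    using integral_mult_weak_pderiv_add[OF \<Omega> H1_0_mult_L2[OF \<Omega> vH1_0_component[OF u] vH1_0_component[OF v]]
        vH1_0_component_H1[OF w] vH1_0_component_H1[OF z]]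
    by (simp add: c_form_sum[OF \<Omega>] u z w v add_closed sum.distrib)
qed

lemma c_form_diagonal_add:
  assumes \<Omega>: "open \<Omega>" and u: "u \<in> vH1_0 \<Omega>" and w: "w \<in> vH1_0 \<Omega>" and v: "v \<in> vH1_0 \<Omega>"
  shows "c_form \<Omega> (\<lambda>x. u x + w x) (\<lambda>x. u x + w x) v =
    c_form \<Omega> u u v + (c_form \<Omega> w w v + c_form \<Omega> w u v + c_form \<Omega> u w v)"
proof -
  interpret function_seminorm "vH1_0 \<Omega>" "vH1_norm \<Omega>" using \<Omega> by (rule function_seminorm_vH1_0)
  show ?thesis
    by (simp add: c_form_add_convecting[OF \<Omega>] c_form_add_convected[OF \<Omega>] add_closed u w v)
qed

section \<open>Random fields and functionals\<close>

lemma simple_function_real_measurable: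
  "simple_function M f \<Longrightarrow> (\<lambda>\<theta>. g (f \<theta>)) \<in> borel_measurable M" for g :: "'c \<Rightarrow> real"
  by (rule borel_measurable_simple_function[OF simple_function_compose1])

context function_seminorm
begin

lemma Bochner_L2_closed: "u \<in> Bochner_L2 M X N \<Longrightarrow> \<theta> \<in> space M \<Longrightarrow> u \<theta> \<in> X"
  by (simp add: Bochner_L2_def)

lemma Bochner_L2E:
  assumes "u \<in> Bochner_L2 M X N"
  obtains s where "\<And>n. simple_function M (s n)" "\<And>n \<theta>. \<theta> \<in> space M \<Longrightarrow> s n \<theta> \<in> X"
    "\<And>\<theta>. \<theta> \<in> space M \<Longrightarrow> (\<lambda>n. N (\<lambda>x. s n \<theta> x - u \<theta> x)) \<longlonglongrightarrow> 0"
  using assms unfolding Bochner_L2_def strongly_measurable_def by blast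

lemma seminorm_tendsto:
  assumes "\<And>n. s n \<in> X" "v \<in> X" "(\<lambda>n. N (\<lambda>x. s n x - v x)) \<longlonglongrightarrow> 0"
  shows "(\<lambda>n. N (s n)) \<longlonglongrightarrow> N v"
proof -
  have "(\<lambda>n. N (s n) - N v) \<longlonglongrightarrow> 0"
    by (rule Lim_null_comparison[OF _ assms(3)]) (auto intro!: always_eventually abs_diff_le assms)
  then show ?thesis by (simp add: LIM_zero_iff)
qed

lemma strongly_measurable_seminorm:
  assumes u: "strongly_measurable M X N u" and uX: "\<And>\<theta>. \<theta> \<in> space M \<Longrightarrow> u \<theta> \<in> X"
  shows "(\<lambda>\<theta>. N (u \<theta>)) \<in> borel_measurable M"
proof -
  obtain s where s: "\<And>n. simple_function M (s n)" "\<And>n \<theta>. \<theta> \<in> space M \<Longrightarrow> s n \<theta> \<in> X"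
    "\<And>\<theta>. \<theta> \<in> space M \<Longrightarrow> (\<lambda>n. N (\<lambda>x. s n \<theta> x - u \<theta> x)) \<longlonglongrightarrow> 0"
    using u unfolding strongly_measurable_def by blast
  show ?thesis
  proof (rule borel_measurable_LIMSEQ_real)
    show "(\<lambda>\<theta>. N (s n \<theta>)) \<in> borel_measurable M" for n
      by (rule simple_function_real_measurable[OF s(1)])
    show "(\<lambda>n. N (s n \<theta>)) \<longlonglongrightarrow> N (u \<theta>)" if "\<theta> \<in> space M" for \<theta>
      using that by (intro seminorm_tendsto s uX)
  qed
qed

lemma Bochner_L2_const:
  assumes "prob_space M" "f \<in> X" shows "(\<lambda>_. f) \<in> Bochner_L2 M X N"
proof -
  interpret prob_space M by fact
  have "N (\<lambda>x. f x - f x) = 0" using scale[OF assms(2), of 0] by simp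
  then show ?thesis
    using assms(2) by (auto simp: Bochner_L2_def strongly_measurable_def intro!: exI[of _ "\<lambda>_ _. f"])
qed

lemma Bochner_L2_scale:
  assumes u: "u \<in> Bochner_L2 M X N" shows "(\<lambda>\<theta> x. r *\<^sub>R u \<theta> x) \<in> Bochner_L2 M X N"
proof -
  obtain s where s: "\<And>n. simple_function M (s n)" "\<And>n \<theta>. \<theta> \<in> space M \<Longrightarrow> s n \<theta> \<in> X"
    "\<And>\<theta>. \<theta> \<in> space M \<Longrightarrow> (\<lambda>n. N (\<lambda>x. s n \<theta> x - u \<theta> x)) \<longlonglongrightarrow> 0"
    using u by (rule Bochner_L2E) blast
  note uX = Bochner_L2_closed[OF u]
  have "strongly_measurable M X N (\<lambda>\<theta> x. r *\<^sub>R u \<theta> x)"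
    unfolding strongly_measurable_def
  proof (intro exI[of _ "\<lambda>n \<theta> x. r *\<^sub>R s n \<theta> x"] conjI allI ballI)
    show "simple_function M (\<lambda>\<theta> x. r *\<^sub>R s n \<theta> x)" for n
      by (rule simple_function_compose1[OF s(1)])
    show "(\<lambda>x. r *\<^sub>R s n \<theta> x) \<in> X" if "\<theta> \<in> space M" for n \<theta>
      using that by (intro scale_closed s)
    show "(\<lambda>n. N (\<lambda>x. r *\<^sub>R s n \<theta> x - r *\<^sub>R u \<theta> x)) \<longlonglongrightarrow> 0" if "\<theta> \<in> space M" for \<theta>
    proof -
      have "(\<lambda>x. r *\<^sub>R s n \<theta> x - r *\<^sub>R u \<theta> x) = (\<lambda>x. r *\<^sub>R (s n \<theta> x - u \<theta> x))" for n
        by (simp add: scaleR_diff_right)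
      then have "N (\<lambda>x. r *\<^sub>R s n \<theta> x - r *\<^sub>R u \<theta> x) = \<bar>r\<bar> * N (\<lambda>x. s n \<theta> x - u \<theta> x)" for n
        using scale[OF diff_closed[OF s(2)[OF that] uX[OF that]]] by simp
      then show ?thesis
        using tendsto_mult_right_zero[OF s(3)[OF that], of "\<bar>r\<bar>"] by simp
    qed
  qed
  moreover have "integrable M (\<lambda>\<theta>. (N (\<lambda>x. r *\<^sub>R u \<theta> x))\<^sup>2)"
  proof -
    have "integrable M (\<lambda>\<theta>. r\<^sup>2 * (N (u \<theta>))\<^sup>2)" using u by (simp add: Bochner_L2_def)
    then show ?thesis
      by (rule Bochner_Integration.integrable_cong[THEN iffD1, OF refl, rotated])
        (simp add: scale[OF uX] power_mult_distrib)
  qed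
  ultimately show ?thesis
    using uX by (auto simp: Bochner_L2_def intro: scale_closed)
qed

text \<open>
  The sums of the simple maps approximating \<open>u\<close> and \<open>v\<close> approximate \<open>u + v\<close>, and the square of the
  seminorm is dominated by \<open>2 * (N u)\<^sup>2 + 2 * (N v)\<^sup>2\<close>.
\<close>
lemma Bochner_L2_add:
  assumes u: "u \<in> Bochner_L2 M X N" and v: "v \<in> Bochner_L2 M X N"
  shows "(\<lambda>\<theta> x. u \<theta> x + v \<theta> x) \<in> Bochner_L2 M X N"
proof -
  obtain s where s: "\<And>n. simple_function M (s n)" "\<And>n \<theta>. \<theta> \<in> space M \<Longrightarrow> s n \<theta> \<in> X"
    "\<And>\<theta>. \<theta> \<in> space M \<Longrightarrow> (\<lambda>n. N (\<lambda>x. s n \<theta> x - u \<theta> x)) \<longlonglongrightarrow> 0"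
    using u by (rule Bochner_L2E) blast
  obtain t where t: "\<And>n. simple_function M (t n)" "\<And>n \<theta>. \<theta> \<in> space M \<Longrightarrow> t n \<theta> \<in> X"
    "\<And>\<theta>. \<theta> \<in> space M \<Longrightarrow> (\<lambda>n. N (\<lambda>x. t n \<theta> x - v \<theta> x)) \<longlonglongrightarrow> 0"
    using v by (rule Bochner_L2E) blast
  note uX = Bochner_L2_closed[OF u] and vX = Bochner_L2_closed[OF v]
  have sm: "strongly_measurable M X N (\<lambda>\<theta> x. u \<theta> x + v \<theta> x)"
    unfolding strongly_measurable_def
  proof (intro exI[of _ "\<lambda>n \<theta> x. s n \<theta> x + t n \<theta> x"] conjI allI ballI)
    show "simple_function M (\<lambda>\<theta> x. s n \<theta> x + t n \<theta> x)" for n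
      by (rule simple_function_compose2[OF s(1) t(1)])
    show "(\<lambda>x. s n \<theta> x + t n \<theta> x) \<in> X" if "\<theta> \<in> space M" for n \<theta>
      using that by (intro add_closed s t)
    show "(\<lambda>n. N (\<lambda>x. (s n \<theta> x + t n \<theta> x) - (u \<theta> x + v \<theta> x))) \<longlonglongrightarrow> 0" if \<theta>: "\<theta> \<in> space M" for \<theta>
    proof (rule Lim_null_comparison)
      have d: "(\<lambda>x. s n \<theta> x - u \<theta> x) \<in> X" "(\<lambda>x. t n \<theta> x - v \<theta> x) \<in> X" for n
        using diff_closed[OF s(2)[OF \<theta>] uX[OF \<theta>]] diff_closed[OF t(2)[OF \<theta>] vX[OF \<theta>]] by auto
      show "\<forall>\<^sub>F n in sequentially. norm (N (\<lambda>x. (s n \<theta> x + t n \<theta> x) - (u \<theta> x + v \<theta> x)))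
          \<le> N (\<lambda>x. s n \<theta> x - u \<theta> x) + N (\<lambda>x. t n \<theta> x - v \<theta> x)"
      proof (intro always_eventually allI)
        fix n
        show "norm (N (\<lambda>x. (s n \<theta> x + t n \<theta> x) - (u \<theta> x + v \<theta> x)))
          \<le> N (\<lambda>x. s n \<theta> x - u \<theta> x) + N (\<lambda>x. t n \<theta> x - v \<theta> x)"
          using triangle[OF d] nonneg[OF add_closed[OF d]] by (simp add: add_diff_add)
      qed
      show "(\<lambda>n. N (\<lambda>x. s n \<theta> x - u \<theta> x) + N (\<lambda>x. t n \<theta> x - v \<theta> x)) \<longlonglongrightarrow> 0"
        using tendsto_add[OF s(3)[OF \<theta>] t(3)[OF \<theta>]] by simp
    qed
  qed
  have "integrable M (\<lambda>\<theta>. (N (\<lambda>x. u \<theta> x + v \<theta> x))\<^sup>2)"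
  proof (rule Bochner_Integration.integrable_bound)
    show "integrable M (\<lambda>\<theta>. 2 * (N (u \<theta>))\<^sup>2 + 2 * (N (v \<theta>))\<^sup>2)"
      using u v by (simp add: Bochner_L2_def)
    show "(\<lambda>\<theta>. (N (\<lambda>x. u \<theta> x + v \<theta> x))\<^sup>2) \<in> borel_measurable M"
      by (intro borel_measurable_power strongly_measurable_seminorm[OF sm] add_closed uX vX)
    show "AE \<theta> in M. norm ((N (\<lambda>x. u \<theta> x + v \<theta> x))\<^sup>2) \<le> norm (2 * (N (u \<theta>))\<^sup>2 + 2 * (N (v \<theta>))\<^sup>2)"
    proof (intro AE_I2)
      fix \<theta> assume \<theta>: "\<theta> \<in> space M"
      have "(N (\<lambda>x. u \<theta> x + v \<theta> x))\<^sup>2 \<le> (N (u \<theta>) + N (v \<theta>))\<^sup>2"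
        using \<theta> by (intro power_mono triangle nonneg add_closed uX vX)
      also have "\<dots> \<le> 2 * (N (u \<theta>))\<^sup>2 + 2 * (N (v \<theta>))\<^sup>2"
        using sum_squares_bound[of "N (u \<theta>)" "N (v \<theta>)"] by (simp add: power2_sum)
      finally show "norm ((N (\<lambda>x. u \<theta> x + v \<theta> x))\<^sup>2) \<le> norm (2 * (N (u \<theta>))\<^sup>2 + 2 * (N (v \<theta>))\<^sup>2)"
        by simp
    qed
  qed
  with sm show ?thesis
    using uX vX by (auto simp: Bochner_L2_def intro: add_closed)
qed

lemma Bochner_L2_diff:
  assumes "u \<in> Bochner_L2 M X N" "v \<in> Bochner_L2 M X N"
  shows "(\<lambda>\<theta> x. u \<theta> x - v \<theta> x) \<in> Bochner_L2 M X N"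
  using Bochner_L2_add[OF assms(1) Bochner_L2_scale[OF assms(2), of "- 1"]] by simp

end

lemma Hminus1_add:
  "F \<in> Hminus1 \<Omega> \<Longrightarrow> u \<in> vH1_0 \<Omega> \<Longrightarrow> v \<in> vH1_0 \<Omega> \<Longrightarrow> F (\<lambda>x. u x + v x) = F u + F v"
  by (simp add: Hminus1_def)

lemma Hminus1_scale: "F \<in> Hminus1 \<Omega> \<Longrightarrow> v \<in> vH1_0 \<Omega> \<Longrightarrow> F (\<lambda>x. r *\<^sub>R v x) = r * F v"
  by (simp add: Hminus1_def)

text \<open>
  The dual norm is a supremum over the unit ball of a seminorm. A field of seminorm zero cannot be
  rescaled to the unit sphere, but functionals in the dual vanish on it.
\<close>
lemma Hminus1_le:
  assumes \<Omega>: "open \<Omega>" and F: "F \<in> Hminus1 \<Omega>" and v: "v \<in> vH1_0 \<Omega>"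
  shows "\<bar>F v\<bar> \<le> Hminus1_norm \<Omega> F * vH1_norm \<Omega> v"
proof -
  interpret function_seminorm "vH1_0 \<Omega>" "vH1_norm \<Omega>" using \<Omega> by (rule function_seminorm_vH1_0)
  let ?B = "{v \<in> vH1_0 \<Omega>. vH1_norm \<Omega> v \<le> 1}"
  obtain C where C: "\<And>v. v \<in> vH1_0 \<Omega> \<Longrightarrow> \<bar>F v\<bar> \<le> C * vH1_norm \<Omega> v"
    using F unfolding Hminus1_def by blast
  show ?thesis
  proof (cases "vH1_norm \<Omega> v = 0")
    case True
    then show ?thesis using C[OF v] by simp
  next
    case False
    then have pos: "vH1_norm \<Omega> v > 0" using nonneg[OF v] by simp
    let ?w = "\<lambda>x. inverse (vH1_norm \<Omega> v) *\<^sub>R v x"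
    have "?w \<in> ?B"
      using pos v by (simp add: scale scale_closed)
    moreover have "bdd_above ((\<lambda>v. \<bar>F v\<bar>) ` ?B)"
    proof (rule bdd_aboveI2)
      fix u assume u: "u \<in> ?B"
      then have "\<bar>F u\<bar> \<le> \<bar>C\<bar> * vH1_norm \<Omega> u"
        using C[of u] nonneg[of u] mult_right_mono[OF abs_ge_self, of "vH1_norm \<Omega> u" C] by auto
      also have "\<dots> \<le> \<bar>C\<bar> * 1" using u by (intro mult_left_mono) auto
      finally show "\<bar>F u\<bar> \<le> \<bar>C\<bar> * 1" .
    qed
    ultimately have "\<bar>F ?w\<bar> \<le> Hminus1_norm \<Omega> F"
      unfolding Hminus1_norm_def by (rule cSUP_upper)
    then show ?thesis
      using pos by (simp add: Hminus1_scale[OF F v] abs_mult field_simps)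
  qed
qed

lemma Hminus1_diff:
  assumes F: "F \<in> Hminus1 \<Omega>" and u: "u \<in> vH1_0 \<Omega>" and v: "v \<in> vH1_0 \<Omega>" and \<Omega>: "open \<Omega>"
  shows "F (\<lambda>x. u x - v x) = F u - F v"
proof -
  interpret function_seminorm "vH1_0 \<Omega>" "vH1_norm \<Omega>" using \<Omega> by (rule function_seminorm_vH1_0)
  have "F (\<lambda>x. u x + (- 1) *\<^sub>R v x) = F u + F (\<lambda>x. (- 1) *\<^sub>R v x)"
    by (rule Hminus1_add[OF F u scale_closed[OF v]])
  also have "F (\<lambda>x. (- 1) *\<^sub>R v x) = - 1 * F v"
    by (rule Hminus1_scale[OF F v])
  finally show ?thesis by simp
qed

lemma Hminus1_diff_functional:
  assumes "F \<in> Hminus1 \<Omega>" "G \<in> Hminus1 \<Omega>" and \<Omega>: "open \<Omega>"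
  shows "(\<lambda>v. F v - G v) \<in> Hminus1 \<Omega>"
proof -
  have "\<bar>F v - G v\<bar> \<le> (Hminus1_norm \<Omega> F + Hminus1_norm \<Omega> G) * vH1_norm \<Omega> v" if "v \<in> vH1_0 \<Omega>" for v
    using Hminus1_le[OF \<Omega> assms(1) that] Hminus1_le[OF \<Omega> assms(2) that] by (simp add: distrib_right)
  then show ?thesis
    using assms unfolding Hminus1_def by (auto simp: right_diff_distrib)
qed

text \<open>
  Pairing the \<open>n\<close>-th approximations of \<open>S\<close> and \<open>v\<close> by simple maps with each other yields simple
  random variables, which converge to \<open>S v\<close> as \<open>S\<^sub>n v\<^sub>n - S v = (S\<^sub>n - S) v\<^sub>n + S (v\<^sub>n - v)\<close>.
\<close>
lemma random_forcing_pairing_integrable: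
  assumes \<Omega>: "open \<Omega>" and S: "S \<in> random_forcings M \<Omega>" and v: "v \<in> V\<^sub>0 M \<Omega>"
  shows "integrable M (\<lambda>\<theta>. S \<theta> (v \<theta>))"
proof -
  interpret function_seminorm "vH1_0 \<Omega>" "vH1_norm \<Omega>" using \<Omega> by (rule function_seminorm_vH1_0)
  let ?N = "vH1_norm \<Omega>" and ?H = "Hminus1_norm \<Omega>"
  have vX: "\<And>\<theta>. \<theta> \<in> space M \<Longrightarrow> v \<theta> \<in> vH1_0 \<Omega>"
    using v by (simp add: V\<^sub>0_def Bochner_L2_closed)
  have SX: "\<And>\<theta>. \<theta> \<in> space M \<Longrightarrow> S \<theta> \<in> Hminus1 \<Omega>"
    using S by (simp add: random_forcings_def Bochner_L2_def)
  obtain s where s: "\<And>n. simple_function M (s n)" "\<And>n \<theta>. \<theta> \<in> space M \<Longrightarrow> s n \<theta> \<in> vH1_0 \<Omega>"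
    "\<And>\<theta>. \<theta> \<in> space M \<Longrightarrow> (\<lambda>n. ?N (\<lambda>x. s n \<theta> x - v \<theta> x)) \<longlonglongrightarrow> 0"
    using v unfolding V\<^sub>0_def by (rule Bochner_L2E) blast
  obtain T where T: "\<And>n. simple_function M (T n)" "\<And>n \<theta>. \<theta> \<in> space M \<Longrightarrow> T n \<theta> \<in> Hminus1 \<Omega>"
    "\<And>\<theta>. \<theta> \<in> space M \<Longrightarrow> (\<lambda>n. ?H (\<lambda>w. T n \<theta> w - S \<theta> w)) \<longlonglongrightarrow> 0"
    using S unfolding random_forcings_def Bochner_L2_def strongly_measurable_def by blast
  show ?thesis
  proof (rule Bochner_Integration.integrable_bound)
    show "integrable M (\<lambda>\<theta>. (?H (S \<theta>))\<^sup>2 + (?N (v \<theta>))\<^sup>2)"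
      using S v by (simp add: random_forcings_def V\<^sub>0_def Bochner_L2_def)
    show "(\<lambda>\<theta>. S \<theta> (v \<theta>)) \<in> borel_measurable M"
    proof (rule borel_measurable_LIMSEQ_real)
      show "(\<lambda>\<theta>. T n \<theta> (s n \<theta>)) \<in> borel_measurable M" for n
        by (rule borel_measurable_simple_function[OF simple_function_compose2[OF T(1) s(1)]])
      show "(\<lambda>n. T n \<theta> (s n \<theta>)) \<longlonglongrightarrow> S \<theta> (v \<theta>)" if \<theta>: "\<theta> \<in> space M" for \<theta>
      proof -
        let ?b = "\<lambda>n. ?H (\<lambda>w. T n \<theta> w - S \<theta> w) * ?N (s n \<theta>) + ?H (S \<theta>) * ?N (\<lambda>x. s n \<theta> x - v \<theta> x)"
        have "(\<lambda>n. T n \<theta> (s n \<theta>) - S \<theta> (v \<theta>)) \<longlonglongrightarrow> 0"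
        proof (rule Lim_null_comparison)
          show "\<forall>\<^sub>F n in sequentially. norm (T n \<theta> (s n \<theta>) - S \<theta> (v \<theta>)) \<le> ?b n"
          proof (intro always_eventually allI)
            fix n
            have "\<bar>T n \<theta> (s n \<theta>) - S \<theta> (s n \<theta>)\<bar> \<le> ?H (\<lambda>w. T n \<theta> w - S \<theta> w) * ?N (s n \<theta>)"
              using Hminus1_le[OF \<Omega> Hminus1_diff_functional[OF T(2)[OF \<theta>] SX[OF \<theta>] \<Omega>] s(2)[OF \<theta>]] .
            moreover have "\<bar>S \<theta> (s n \<theta>) - S \<theta> (v \<theta>)\<bar> \<le> ?H (S \<theta>) * ?N (\<lambda>x. s n \<theta> x - v \<theta> x)"
              using Hminus1_le[OF \<Omega> SX[OF \<theta>] diff_closed[OF s(2)[OF \<theta>] vX[OF \<theta>]]]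
              by (simp add: Hminus1_diff[OF SX[OF \<theta>] s(2)[OF \<theta>] vX[OF \<theta>] \<Omega>])
            ultimately show "norm (T n \<theta> (s n \<theta>) - S \<theta> (v \<theta>)) \<le> ?b n"
              by simp
          qed
          have "(\<lambda>n. ?N (s n \<theta>)) \<longlonglongrightarrow> ?N (v \<theta>)"
            using \<theta> by (intro seminorm_tendsto s vX)
          then have "?b \<longlonglongrightarrow> 0 * ?N (v \<theta>) + ?H (S \<theta>) * 0"
            using \<theta> by (intro tendsto_intros T s)
          then show "?b \<longlonglongrightarrow> 0" by simp
        qed
        then show ?thesis by (simp add: LIM_zero_iff)
      qed
    qed
    show "AE \<theta> in M. norm (S \<theta> (v \<theta>)) \<le> norm ((?H (S \<theta>))\<^sup>2 + (?N (v \<theta>))\<^sup>2)"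
    proof (intro AE_I2)
      fix \<theta> assume \<theta>: "\<theta> \<in> space M"
      have "\<bar>S \<theta> (v \<theta>)\<bar> \<le> ?H (S \<theta>) * ?N (v \<theta>)"
        using \<theta> by (intro Hminus1_le \<Omega> SX vX)
      moreover have "2 * (?H (S \<theta>) * ?N (v \<theta>)) \<le> (?H (S \<theta>))\<^sup>2 + (?N (v \<theta>))\<^sup>2"
        using sum_squares_bound[of "?H (S \<theta>)" "?N (v \<theta>)"] by simp
      ultimately have "\<bar>S \<theta> (v \<theta>)\<bar> \<le> (?H (S \<theta>))\<^sup>2 + (?N (v \<theta>))\<^sup>2"
        using abs_ge_zero[of "S \<theta> (v \<theta>)"] by linarith
      then show "norm (S \<theta> (v \<theta>)) \<le> norm ((?H (S \<theta>))\<^sup>2 + (?N (v \<theta>))\<^sup>2)" by simp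
    qed
  qed
qed

text \<open>
  A constant functional is a random forcing. Its approximation error is the supremum of the zero
  function over the unit ball, which is zero only because the ball is nonempty; this is read off
  from the field \<open>v\<close>.
\<close>
lemma deterministic_forcing_pairing_integrable:
  assumes M: "prob_space M" and \<Omega>: "open \<Omega>" and F: "F \<in> Hminus1 \<Omega>" and v: "v \<in> V\<^sub>0 M \<Omega>"
  shows "integrable M (\<lambda>\<theta>. F (v \<theta>))"
proof -
  interpret prob_space M by fact
  interpret function_seminorm "vH1_0 \<Omega>" "vH1_norm \<Omega>" using \<Omega> by (rule function_seminorm_vH1_0)
  obtain \<theta> where "\<theta> \<in> space M" using not_empty by blast
  then have "v \<theta> \<in> vH1_0 \<Omega>" using v by (simp add: V\<^sub>0_def Bochner_L2_closed)
  then have "(\<lambda>x. 0 *\<^sub>R v \<theta> x) \<in> {v \<in> vH1_0 \<Omega>. vH1_norm \<Omega> v \<le> 1}"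
    using scale[of "v \<theta>" 0] scale_closed[of "v \<theta>" 0] by simp
  then have "{v \<in> vH1_0 \<Omega>. vH1_norm \<Omega> v \<le> 1} \<noteq> {}" by blast
  then have "Hminus1_norm \<Omega> (\<lambda>v. F v - F v) = 0"
    unfolding Hminus1_norm_def by simp
  then have "(\<lambda>_. F) \<in> random_forcings M \<Omega>"
    using F by (auto simp: random_forcings_def Bochner_L2_def strongly_measurable_def intro!: exI[of _ "\<lambda>_ _. F"])
  then show ?thesis
    using random_forcing_pairing_integrable[OF \<Omega> _ v] by blast
qed

lemma has_expectation_add:
  assumes "prob_space M" "has_expectation M X a" "has_expectation M Y b"
    "\<And>\<theta>. \<theta> \<in> space M \<Longrightarrow> Z \<theta> = X \<theta> + Y \<theta>" "c = a + b"
  shows "has_expectation M Z c"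
proof -
  have "integrable M (\<lambda>\<theta>. X \<theta> + Y \<theta>)" "(\<integral>\<theta>. X \<theta> + Y \<theta> \<partial>M) = c"
    using assms by (auto simp: has_expectation_def)
  moreover have "integrable M Z = integrable M (\<lambda>\<theta>. X \<theta> + Y \<theta>)" "(\<integral>\<theta>. Z \<theta> \<partial>M) = (\<integral>\<theta>. X \<theta> + Y \<theta> \<partial>M)"
    using assms(4) by (intro Bochner_Integration.integrable_cong Bochner_Integration.integral_cong; simp)+
  ultimately show ?thesis by (simp add: has_expectation_def)
qed

lemma has_expectation_diff:
  assumes "prob_space M" "has_expectation M X a" "has_expectation M Y b"
    "\<And>\<theta>. \<theta> \<in> space M \<Longrightarrow> Z \<theta> = X \<theta> - Y \<theta>" "c = a - b"
  shows "has_expectation M Z c"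
proof (rule has_expectation_add[OF assms(1,2)])
  show "has_expectation M (\<lambda>\<theta>. - Y \<theta>) (- b)"
    using assms(3) by (simp add: has_expectation_def)
qed (use assms in auto)

section \<open>The decomposition of the stochastic Navier--Stokes system\<close>

text \<open>
  For every realisation \<open>\<theta>\<close> the integrand of the momentum equation of (A) is the sum of those of
  (B) and (C), the pressures being added.
\<close>
lemma solves_B_C_imp_solves_A:
  assumes M: "prob_space M" and \<Omega>: "open \<Omega>" "bounded \<Omega>"
    and F: "F \<in> Hminus1 \<Omega>" and S: "S \<in> random_forcings M \<Omega>"
    and B: "solves_B M \<Omega> \<nu> F \<xi> p\<^sub>1" and C: "solves_C M \<Omega> \<nu> \<xi> S \<eta> p\<^sub>2"
  shows "solves_A M \<Omega> \<nu> F S (\<lambda>\<theta> x. \<xi> x + \<eta> \<theta> x) (\<lambda>\<theta> x. p\<^sub>1 \<theta> x + p\<^sub>2 \<theta> x)"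
proof -
  interpret V: function_seminorm "vH1_0 \<Omega>" "vH1_norm \<Omega>" using \<Omega>(1) by (rule function_seminorm_vH1_0)
  interpret W: function_seminorm "L2_0 \<Omega>" "L2_norm \<Omega>" using \<Omega>(2,1) by (rule function_seminorm_L2_0)
  have \<xi>: "\<xi> \<in> vH1_0 \<Omega>" and \<eta>: "\<eta> \<in> V\<^sub>0 M \<Omega>" and p: "p\<^sub>1 \<in> W\<^sub>0 M \<Omega>" "p\<^sub>2 \<in> W\<^sub>0 M \<Omega>"
    using B C by (auto simp: solves_B_def solves_C_def)
  have V0: "v \<theta> \<in> vH1_0 \<Omega>" if "v \<in> V\<^sub>0 M \<Omega>" "\<theta> \<in> space M" for v \<theta>
    using that unfolding V\<^sub>0_def by (rule V.Bochner_L2_closed)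
  have W0: "q \<theta> \<in> L2 \<Omega>" if "q \<in> W\<^sub>0 M \<Omega>" "\<theta> \<in> space M" for q \<theta>
    using W.Bochner_L2_closed[OF that[unfolded W\<^sub>0_def]] by (simp add: L2_0_def)
  show ?thesis
    unfolding solves_A_def
  proof (intro conjI ballI)
    show "(\<lambda>\<theta> x. \<xi> x + \<eta> \<theta> x) \<in> V\<^sub>0 M \<Omega>"
      using V.Bochner_L2_add[OF V.Bochner_L2_const[OF M \<xi>]] \<eta> by (simp add: V\<^sub>0_def)
    show "(\<lambda>\<theta> x. p\<^sub>1 \<theta> x + p\<^sub>2 \<theta> x) \<in> W\<^sub>0 M \<Omega>"
      using p unfolding W\<^sub>0_def by (rule W.Bochner_L2_add)
  next
    fix v assume v: "v \<in> V\<^sub>0 M \<Omega>"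
    show "has_expectation M
        (\<lambda>\<theta>. a_form \<Omega> \<nu> (\<lambda>x. \<xi> x + \<eta> \<theta> x) (v \<theta>)
             + c_form \<Omega> (\<lambda>x. \<xi> x + \<eta> \<theta> x) (\<lambda>x. \<xi> x + \<eta> \<theta> x) (v \<theta>)
             + b_form \<Omega> (v \<theta>) (\<lambda>x. p\<^sub>1 \<theta> x + p\<^sub>2 \<theta> x))
        (prob_space.expectation M (\<lambda>\<theta>. F (v \<theta>) + S \<theta> (v \<theta>)))"
    proof (rule has_expectation_add[OF M])
      show "has_expectation M
          (\<lambda>\<theta>. a_form \<Omega> \<nu> \<xi> (v \<theta>) + c_form \<Omega> \<xi> \<xi> (v \<theta>) + b_form \<Omega> (v \<theta>) (p\<^sub>1 \<theta>))
          (prob_space.expectation M (\<lambda>\<theta>. F (v \<theta>)))"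
        using B v by (simp add: solves_B_def)
      show "has_expectation M
          (\<lambda>\<theta>. a_form \<Omega> \<nu> (\<eta> \<theta>) (v \<theta>) + c_form \<Omega> (\<eta> \<theta>) (\<eta> \<theta>) (v \<theta>)
             + c_form \<Omega> (\<eta> \<theta>) \<xi> (v \<theta>) + c_form \<Omega> \<xi> (\<eta> \<theta>) (v \<theta>) + b_form \<Omega> (v \<theta>) (p\<^sub>2 \<theta>))
          (prob_space.expectation M (\<lambda>\<theta>. S \<theta> (v \<theta>)))"
        using C v by (simp add: solves_C_def)
      show "prob_space.expectation M (\<lambda>\<theta>. F (v \<theta>) + S \<theta> (v \<theta>)) =
          prob_space.expectation M (\<lambda>\<theta>. F (v \<theta>)) + prob_space.expectation M (\<lambda>\<theta>. S \<theta> (v \<theta>))"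
        by (intro Bochner_Integration.integral_add deterministic_forcing_pairing_integrable[OF M \<Omega>(1) F v]
            random_forcing_pairing_integrable[OF \<Omega>(1) S v])
    next
      fix \<theta> assume \<theta>: "\<theta> \<in> space M"
      note v\<theta> = V0[OF v \<theta>] and \<eta>\<theta> = V0[OF \<eta> \<theta>]
      show "a_form \<Omega> \<nu> (\<lambda>x. \<xi> x + \<eta> \<theta> x) (v \<theta>)
             + c_form \<Omega> (\<lambda>x. \<xi> x + \<eta> \<theta> x) (\<lambda>x. \<xi> x + \<eta> \<theta> x) (v \<theta>)
             + b_form \<Omega> (v \<theta>) (\<lambda>x. p\<^sub>1 \<theta> x + p\<^sub>2 \<theta> x) =
          (a_form \<Omega> \<nu> \<xi> (v \<theta>) + c_form \<Omega> \<xi> \<xi> (v \<theta>) + b_form \<Omega> (v \<theta>) (p\<^sub>1 \<theta>)) +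
          (a_form \<Omega> \<nu> (\<eta> \<theta>) (v \<theta>) + c_form \<Omega> (\<eta> \<theta>) (\<eta> \<theta>) (v \<theta>)
             + c_form \<Omega> (\<eta> \<theta>) \<xi> (v \<theta>) + c_form \<Omega> \<xi> (\<eta> \<theta>) (v \<theta>) + b_form \<Omega> (v \<theta>) (p\<^sub>2 \<theta>))"
        unfolding a_form_add[OF \<Omega>(1) \<xi> \<eta>\<theta> v\<theta>] c_form_diagonal_add[OF \<Omega>(1) \<xi> \<eta>\<theta> v\<theta>]
          b_form_pressure_add[OF \<Omega>(1) v\<theta> W0[OF p(1) \<theta>] W0[OF p(2) \<theta>]]
        by simp
    qed
  next
    show "divergence_free M \<Omega> (\<lambda>\<theta> x. \<xi> x + \<eta> \<theta> x)"
      unfolding divergence_free_def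
    proof
      fix q assume q: "q \<in> W\<^sub>0 M \<Omega>"
      show "has_expectation M (\<lambda>\<theta>. b_form \<Omega> (\<lambda>x. \<xi> x + \<eta> \<theta> x) (q \<theta>)) 0"
      proof (rule has_expectation_add[OF M])
        show "has_expectation M (\<lambda>\<theta>. b_form \<Omega> \<xi> (q \<theta>)) 0"
          using B q by (simp add: solves_B_def divergence_free_def)
        show "has_expectation M (\<lambda>\<theta>. b_form \<Omega> (\<eta> \<theta>) (q \<theta>)) 0"
          using C q by (simp add: solves_C_def divergence_free_def)
      qed (use b_form_add[OF \<Omega>(1) \<xi> V0[OF \<eta>] W0[OF q]] in auto)
    qed
  qed
qed

text \<open>
  The identity between the integrands is read in the other direction, with \<open>u\<close> written as
  \<open>\<xi> + \<eta>\<close>.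
\<close>
lemma solves_A_B_imp_solves_C:
  assumes M: "prob_space M" and \<Omega>: "open \<Omega>" "bounded \<Omega>"
    and F: "F \<in> Hminus1 \<Omega>" and S: "S \<in> random_forcings M \<Omega>"
    and A: "solves_A M \<Omega> \<nu> F S u p" and B: "solves_B M \<Omega> \<nu> F \<xi> p\<^sub>1"
  shows "solves_C M \<Omega> \<nu> \<xi> S (\<lambda>\<theta> x. u \<theta> x - \<xi> x) (\<lambda>\<theta> x. p \<theta> x - p\<^sub>1 \<theta> x)"
proof -
  interpret V: function_seminorm "vH1_0 \<Omega>" "vH1_norm \<Omega>" using \<Omega>(1) by (rule function_seminorm_vH1_0)
  interpret W: function_seminorm "L2_0 \<Omega>" "L2_norm \<Omega>" using \<Omega>(2,1) by (rule function_seminorm_L2_0)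
  define \<eta> where "\<eta> = (\<lambda>\<theta> x. u \<theta> x - \<xi> x)"
  have \<xi>: "\<xi> \<in> vH1_0 \<Omega>" and u: "u \<in> V\<^sub>0 M \<Omega>" and p: "p \<in> W\<^sub>0 M \<Omega>" "p\<^sub>1 \<in> W\<^sub>0 M \<Omega>"
    using A B by (auto simp: solves_A_def solves_B_def)
  have \<eta>: "\<eta> \<in> V\<^sub>0 M \<Omega>"
    using u V.Bochner_L2_diff[OF _ V.Bochner_L2_const[OF M \<xi>]] by (simp add: V\<^sub>0_def \<eta>_def)
  have u_eq: "u \<theta> = (\<lambda>x. \<xi> x + \<eta> \<theta> x)" for \<theta>
    by (simp add: \<eta>_def)
  have V0: "v \<theta> \<in> vH1_0 \<Omega>" if "v \<in> V\<^sub>0 M \<Omega>" "\<theta> \<in> space M" for v \<theta>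
    using that unfolding V\<^sub>0_def by (rule V.Bochner_L2_closed)
  have W0: "q \<theta> \<in> L2 \<Omega>" if "q \<in> W\<^sub>0 M \<Omega>" "\<theta> \<in> space M" for q \<theta>
    using W.Bochner_L2_closed[OF that[unfolded W\<^sub>0_def]] by (simp add: L2_0_def)
  have "solves_C M \<Omega> \<nu> \<xi> S \<eta> (\<lambda>\<theta> x. p \<theta> x - p\<^sub>1 \<theta> x)"
    unfolding solves_C_def
  proof (intro conjI ballI)
    show "\<eta> \<in> V\<^sub>0 M \<Omega>" by (rule \<eta>)
    show "(\<lambda>\<theta> x. p \<theta> x - p\<^sub>1 \<theta> x) \<in> W\<^sub>0 M \<Omega>"
      using p unfolding W\<^sub>0_def by (rule W.Bochner_L2_diff)
  next
    fix v assume v: "v \<in> V\<^sub>0 M \<Omega>"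
    show "has_expectation M
        (\<lambda>\<theta>. a_form \<Omega> \<nu> (\<eta> \<theta>) (v \<theta>) + c_form \<Omega> (\<eta> \<theta>) (\<eta> \<theta>) (v \<theta>)
             + c_form \<Omega> (\<eta> \<theta>) \<xi> (v \<theta>) + c_form \<Omega> \<xi> (\<eta> \<theta>) (v \<theta>)
             + b_form \<Omega> (v \<theta>) (\<lambda>x. p \<theta> x - p\<^sub>1 \<theta> x))
        (prob_space.expectation M (\<lambda>\<theta>. S \<theta> (v \<theta>)))"
    proof (rule has_expectation_diff[OF M])
      show "has_expectation M
          (\<lambda>\<theta>. a_form \<Omega> \<nu> (u \<theta>) (v \<theta>) + c_form \<Omega> (u \<theta>) (u \<theta>) (v \<theta>) + b_form \<Omega> (v \<theta>) (p \<theta>))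
          (prob_space.expectation M (\<lambda>\<theta>. F (v \<theta>) + S \<theta> (v \<theta>)))"
        using A v by (simp add: solves_A_def)
      show "has_expectation M
          (\<lambda>\<theta>. a_form \<Omega> \<nu> \<xi> (v \<theta>) + c_form \<Omega> \<xi> \<xi> (v \<theta>) + b_form \<Omega> (v \<theta>) (p\<^sub>1 \<theta>))
          (prob_space.expectation M (\<lambda>\<theta>. F (v \<theta>)))"
        using B v by (simp add: solves_B_def)
      have "prob_space.expectation M (\<lambda>\<theta>. F (v \<theta>) + S \<theta> (v \<theta>)) =
          prob_space.expectation M (\<lambda>\<theta>. F (v \<theta>)) + prob_space.expectation M (\<lambda>\<theta>. S \<theta> (v \<theta>))"
        by (intro Bochner_Integration.integral_add deterministic_forcing_pairing_integrable[OF M \<Omega>(1) F v]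
            random_forcing_pairing_integrable[OF \<Omega>(1) S v])
      then show "prob_space.expectation M (\<lambda>\<theta>. S \<theta> (v \<theta>)) =
          prob_space.expectation M (\<lambda>\<theta>. F (v \<theta>) + S \<theta> (v \<theta>)) - prob_space.expectation M (\<lambda>\<theta>. F (v \<theta>))"
        by simp
    next
      fix \<theta> assume \<theta>: "\<theta> \<in> space M"
      note v\<theta> = V0[OF v \<theta>] and \<eta>\<theta> = V0[OF \<eta> \<theta>]
      show "a_form \<Omega> \<nu> (\<eta> \<theta>) (v \<theta>) + c_form \<Omega> (\<eta> \<theta>) (\<eta> \<theta>) (v \<theta>)
             + c_form \<Omega> (\<eta> \<theta>) \<xi> (v \<theta>) + c_form \<Omega> \<xi> (\<eta> \<theta>) (v \<theta>)
             + b_form \<Omega> (v \<theta>) (\<lambda>x. p \<theta> x - p\<^sub>1 \<theta> x) =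
          (a_form \<Omega> \<nu> (u \<theta>) (v \<theta>) + c_form \<Omega> (u \<theta>) (u \<theta>) (v \<theta>) + b_form \<Omega> (v \<theta>) (p \<theta>)) -
          (a_form \<Omega> \<nu> \<xi> (v \<theta>) + c_form \<Omega> \<xi> \<xi> (v \<theta>) + b_form \<Omega> (v \<theta>) (p\<^sub>1 \<theta>))"
        unfolding u_eq a_form_add[OF \<Omega>(1) \<xi> \<eta>\<theta> v\<theta>] c_form_diagonal_add[OF \<Omega>(1) \<xi> \<eta>\<theta> v\<theta>]
          b_form_pressure_diff[OF \<Omega>(1) v\<theta> W0[OF p(1) \<theta>] W0[OF p(2) \<theta>]]
        by simp
    qed
  next
    show "divergence_free M \<Omega> \<eta>"
      unfolding divergence_free_def
    proof
      fix q assume q: "q \<in> W\<^sub>0 M \<Omega>"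
      show "has_expectation M (\<lambda>\<theta>. b_form \<Omega> (\<eta> \<theta>) (q \<theta>)) 0"
      proof (rule has_expectation_diff[OF M])
        show "has_expectation M (\<lambda>\<theta>. b_form \<Omega> (u \<theta>) (q \<theta>)) 0"
          using A q by (simp add: solves_A_def divergence_free_def)
        show "has_expectation M (\<lambda>\<theta>. b_form \<Omega> \<xi> (q \<theta>)) 0"
          using B q by (simp add: solves_B_def divergence_free_def)
        show "b_form \<Omega> (\<eta> \<theta>) (q \<theta>) = b_form \<Omega> (u \<theta>) (q \<theta>) - b_form \<Omega> \<xi> (q \<theta>)"
          if "\<theta> \<in> space M" for \<theta>
          unfolding u_eq b_form_add[OF \<Omega>(1) \<xi> V0[OF \<eta> that] W0[OF q that]] by simp
      qed simp
    qed
  qed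
  then show ?thesis unfolding \<eta>_def .
qed

theorem theorem3p1:
  fixes M :: "'t measure" and \<Omega> :: "(real ^ 2) set" and \<nu> :: real
    and F :: "vector_field \<Rightarrow> real" and S :: "'t \<Rightarrow> vector_field \<Rightarrow> real"
  assumes "prob_space M"
    and "open \<Omega>" and "bounded \<Omega>" and "connected \<Omega>" and "lipschitz_boundary \<Omega>"
    and "\<nu> > 0"
    and "F \<in> Hminus1 \<Omega>"
    and "S \<in> random_forcings M \<Omega>"
  shows "(\<forall>\<xi> \<eta>. (\<exists>p\<^sub>1. solves_B M \<Omega> \<nu> F \<xi> p\<^sub>1) \<and> (\<exists>p\<^sub>2. solves_C M \<Omega> \<nu> \<xi> S \<eta> p\<^sub>2) \<longrightarrow>
            (\<exists>p. solves_A M \<Omega> \<nu> F S (\<lambda>\<theta> x. \<xi> x + \<eta> \<theta> x) p)) \<and>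
         (\<forall>u \<xi>. (\<exists>p. solves_A M \<Omega> \<nu> F S u p) \<and> (\<exists>p\<^sub>1. solves_B M \<Omega> \<nu> F \<xi> p\<^sub>1) \<longrightarrow>
            (\<exists>p\<^sub>2. solves_C M \<Omega> \<nu> \<xi> S (\<lambda>\<theta> x. u \<theta> x - \<xi> x) p\<^sub>2))"
  using solves_B_C_imp_solves_A[OF assms(1-3,7,8)] solves_A_B_imp_solves_C[OF assms(1-3,7,8)]
  by blast

end
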